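(* Let $\mathcal P_8$ be the unit regular octahedron and let $(n_1,\dots,n_8)$ be an admissible labeling. Suppose $F_{n_1}$ and $F_{n_5}$ are distinct faces which are neither opposite nor adjacent, and let $p_1=(F_{n_1},F_{n_2},x_1,y_1)$ and $p_2=(F_{n_5},F_{n_6},x_2,y_2)$. Then there are two landscapes whose dual graph is a path of three vertices from $F_{n_1}$ to $F_{n_5}$, namely $L_2(F_{n_1}\rightarrow F_{n_5})$ consisting of the consecutive faces $F_{n_1},F_{n_2},F_{n_5}$ and $L_3(F_{n_1}\rightarrow F_{n_5})$ consisting of the consecutive faces $F_{n_1},F_{n_6},F_{n_5}$, and \[|T_{L_2}(p_1,p_2)|=\sqrt{\left(\tfrac{1-x_1+\sqrt3 y_1}{2}-x_2+1\right)^2+\left(\tfrac{\sqrt3-\sqrt3x_1-y_1}{2}-y_2\right)^2},\] \[|T_{L_3}(p_1,p_2)|=\sqrt{\left(x_1-1-\tfrac{1-x_2+\sqrt3 y_2}{2}\right)^2+\left(y_1-\tfrac{\sqrt3-\sqrt3x_2-y_2}{2}\right)^2}.\]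
   Context: $\mathcal P_8$ is a regular octahedron all of whose edges have length $1$, with faces labeled $F_1,\dots,F_8$ and vertices identified with the sets $\{1,4,6,7\},\{1,2,5,6\},\{1,2,3,4\},\{2,3,5,8\},\{3,4,7,8\},\{5,6,7,8\}$, where face $F_n$ is incident to a vertex $S$ iff $n\in S$ (so $F_b$ and $F_c$ are opposite iff $b+c=9$). Admissible labeling: a permutation $(n_1,\dots,n_8)$ of $(1,\dots,8)$ such that $F_{n_b}$ and $F_{n_c}$ are opposite faces whenever $b+c=9$, and the three faces $F_{n_2},F_{n_4},F_{n_6}$ adjacent to $F_{n_1}$ occur around $F_{n_1}$ (viewed from outside) in the same rotational order as $F_2,F_4,F_6$ occur around $F_1$. Representation of a point: if $p$ lies on face $F_n$ and $F_m$ is a face sharing an edge $e$ with $F_n$, let $g$ be the distance-preserving map of $F_n$ onto a triangle in the upper half-plane sending $e$ onto the segment from $(0,0)$ to $(1,0)$, with the exterior side of $F_n$ facing the viewer. If $g(p)=(x_0,y_0)$, then $(F_n,F_m,x_0,y_0)$ is a representation of $p$. Landscape: given a net $N$ of $\mathcal P_8$, its dual graph has the faces as vertices, adjacent iff they share an edge in $N$. If $H$ is a subgraph of the dual graph that is a path on at least two vertices, the union of the corresponding faces of $N$ is a landscape with dual graph $H$, written $L(F_a\rightarrow F_b)$ if its end faces are $F_a$ (origin) and $F_b$ (destination). Trail length: for points $q_1,q_2$ in a landscape $L$, embed $L$ isometrically in the plane (exterior sides up); $|T_L(q_1,q_2)|$ is the length of the straight segment joining their images if it lies inside the image of $L$,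 and $\infty$ otherwise.
   Formalization: The incidences fix the labeled octahedron only up to reflection; the formal version assumes F_2, F_4, F_6 run clockwise around F_1 seen from outside. In the mirror image the formulas fail: for p_1=p_2 the vertex {1,2,5,6}, the L_2 formula gives √3 instead of 0. *)

theory Defs
  imports "HOL-Analysis.Analysis"
begin

text \<open>
  A vertex is named by the set of labels of its four incident faces; a placement of the octahedron
  in space is a map \<open>v\<close> from vertex names to points of 3-space. The plane is \<open>real \<times> real\<close>,
  whose library metric is the Euclidean one.
\<close>

definition oct_vertices :: "nat set set" where
  "oct_vertices = {{1,4,6,7}, {1,2,5,6}, {1,2,3,4}, {2,3,5,8}, {3,4,7,8}, {5,6,7,8}}"

definition opposite :: "nat \<Rightarrow> nat \<Rightarrow> bool" where
  "opposite a b \<longleftrightarrow> a \<in> {1..8} \<and> b \<in> {1..8} \<and> {S \<in> oct_vertices. a \<in> S \<and> b \<in> S} = {}"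

definition adjacent :: "nat \<Rightarrow> nat \<Rightarrow> bool" where
  "adjacent a b \<longleftrightarrow> a \<noteq> b \<and> card {S \<in> oct_vertices. a \<in> S \<and> b \<in> S} = 2"

definition face :: "(nat set \<Rightarrow> real^3) \<Rightarrow> nat \<Rightarrow> (real^3) set" where
  "face v a = convex hull (v ` {S \<in> oct_vertices. a \<in> S})"

definition common_edge :: "(nat set \<Rightarrow> real^3) \<Rightarrow> nat \<Rightarrow> nat \<Rightarrow> (real^3) set" where
  "common_edge v a b = convex hull (v ` {S \<in> oct_vertices. a \<in> S \<and> b \<in> S})"

definition oct_center :: "(nat set \<Rightarrow> real^3) \<Rightarrow> real^3" where
  "oct_center v = (1/6) *\<^sub>R (\<Sum>S\<in>oct_vertices. v S)"

definition face_center :: "(nat set \<Rightarrow> real^3) \<Rightarrow> nat \<Rightarrow> real^3" where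
  "face_center v a = (1/3) *\<^sub>R (\<Sum>S\<in>{S \<in> oct_vertices. a \<in> S}. v S)"

definition outward_normal :: "(nat set \<Rightarrow> real^3) \<Rightarrow> nat \<Rightarrow> real^3" where
  "outward_normal v a = face_center v a - oct_center v"

text \<open>
  Positive iff \<open>p, q, r\<close> (projected to the plane of face \<open>a\<close>) run counterclockwise for a viewer
  looking at face \<open>a\<close> from outside, negative iff they run clockwise.
\<close>

definition outside_orientation ::
    "(nat set \<Rightarrow> real^3) \<Rightarrow> nat \<Rightarrow> real^3 \<Rightarrow> real^3 \<Rightarrow> real^3 \<Rightarrow> real" where
  "outside_orientation v a p q r = outward_normal v a \<bullet> cross3 (q - p) (r - p)"

definition plane_orientation :: "real \<times> real \<Rightarrow> real \<times> real \<Rightarrow> real \<times> real \<Rightarrow> real" where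
  "plane_orientation p q r =
     (fst q - fst p) * (snd r - snd p) - (snd q - snd p) * (fst r - fst p)"

definition clockwise_around ::
    "(nat set \<Rightarrow> real^3) \<Rightarrow> nat \<Rightarrow> nat \<Rightarrow> nat \<Rightarrow> nat \<Rightarrow> bool" where
  "clockwise_around v a b c d \<longleftrightarrow>
     outside_orientation v a (face_center v b) (face_center v c) (face_center v d) < 0"

text \<open>
  The regular octahedron with center \<open>c\<close> and axes \<open>e1, e2, e3\<close>; vertices at distance
  \<open>1 / sqrt 2\<close> from the center give edge length 1, and antipodal vertices have disjoint names.
  The incidences determine the labelling only up to reflection. The last clause selects the
  mirror image in which faces 2, 4, 6 run clockwise around face 1 as seen from outside: it is the
  one for which the distance formulas hold in coordinates that show exterior sides.
\<close>

definition unit_octahedron :: "(nat set \<Rightarrow> real^3) \<Rightarrow> bool" where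
  "unit_octahedron v \<longleftrightarrow>
     (\<exists>c e1 e2 e3.
        norm e1 = 1 \<and> norm e2 = 1 \<and> norm e3 = 1 \<and>
        e1 \<bullet> e2 = 0 \<and> e1 \<bullet> e3 = 0 \<and> e2 \<bullet> e3 = 0 \<and>
        v {1,4,6,7} = c + (1 / sqrt 2) *\<^sub>R e1 \<and> v {2,3,5,8} = c - (1 / sqrt 2) *\<^sub>R e1 \<and>
        v {1,2,5,6} = c + (1 / sqrt 2) *\<^sub>R e2 \<and> v {3,4,7,8} = c - (1 / sqrt 2) *\<^sub>R e2 \<and>
        v {1,2,3,4} = c + (1 / sqrt 2) *\<^sub>R e3 \<and> v {5,6,7,8} = c - (1 / sqrt 2) *\<^sub>R e3) \<and>
     clockwise_around v 1 2 4 6"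

definition admissible_labeling :: "(nat set \<Rightarrow> real^3) \<Rightarrow> (nat \<Rightarrow> nat) \<Rightarrow> bool" where
  "admissible_labeling v n \<longleftrightarrow>
     bij_betw n {1..8} {1..8} \<and>
     (\<forall>b\<in>{1..8}. \<forall>c\<in>{1..8}. b + c = 9 \<longrightarrow> opposite (n b) (n c)) \<and>
     adjacent (n 1) (n 2) \<and> adjacent (n 1) (n 4) \<and> adjacent (n 1) (n 6) \<and>
     (clockwise_around v (n 1) (n 2) (n 4) (n 6) \<longleftrightarrow> clockwise_around v 1 2 4 6)"

text \<open>An isometric copy of face \<open>a\<close> in the plane with its exterior side facing the viewer.\<close>

definition flat_placement ::
    "(nat set \<Rightarrow> real^3) \<Rightarrow> nat \<Rightarrow> (real^3 \<Rightarrow> real \<times> real) \<Rightarrow> bool" where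
  "flat_placement v a g \<longleftrightarrow>
     (\<forall>p\<in>face v a. \<forall>q\<in>face v a. dist (g p) (g q) = dist p q) \<and>
     (\<forall>p\<in>face v a. \<forall>q\<in>face v a. \<forall>r\<in>face v a.
        0 < outside_orientation v a p q r \<longleftrightarrow> 0 < plane_orientation (g p) (g q) (g r))"

definition is_representation ::
    "(nat set \<Rightarrow> real^3) \<Rightarrow> real^3 \<Rightarrow> nat \<Rightarrow> nat \<Rightarrow> real \<Rightarrow> real \<Rightarrow> bool" where
  "is_representation v p a b x y \<longleftrightarrow>
     adjacent a b \<and> p \<in> face v a \<and>
     (\<exists>g. flat_placement v a g \<and>
          g ` face v a \<subseteq> {z. 0 \<le> snd z} \<and>
          g ` common_edge v a b = closed_segment (0, 0) (1, 0) \<and>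
          g p = (x, y))"

text \<open>Paths in a graph on face labels with edge set \<open>T\<close>, as lists of vertices.\<close>

definition is_path :: "nat set set \<Rightarrow> nat list \<Rightarrow> bool" where
  "is_path T fs \<longleftrightarrow> fs \<noteq> [] \<and> distinct fs \<and> successively (\<lambda>a b. {a, b} \<in> T) fs"

definition path_edges :: "nat list \<Rightarrow> nat set set" where
  "path_edges fs = {{fs ! i, fs ! Suc i} | i. Suc i < length fs}"

definition spanning_tree :: "nat set set \<Rightarrow> bool" where
  "spanning_tree T \<longleftrightarrow>
     T \<subseteq> {{a, b} | a b. adjacent a b} \<and>
     (\<forall>a\<in>{1..8}. \<forall>b\<in>{1..8}. \<exists>fs. is_path T fs \<and> hd fs = a \<and> last fs = b) \<and>
     \<not> (\<exists>fs. 3 \<le> length fs \<and> is_path T fs \<and> {last fs, hd fs} \<in> T)"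

text \<open>
  The faces in \<open>A\<close>, glued along the edges in \<open>T\<close> and cut along all others, laid out in the plane
  without overlap. There is one map per face because a point on a cut edge has several images.
\<close>

definition planar_layout ::
    "(nat set \<Rightarrow> real^3) \<Rightarrow> nat set \<Rightarrow> nat set set \<Rightarrow> (nat \<Rightarrow> real^3 \<Rightarrow> real \<times> real) \<Rightarrow> bool" where
  "planar_layout v A T h \<longleftrightarrow>
     (\<forall>a\<in>A. flat_placement v a (h a)) \<and>
     (\<forall>a\<in>A. \<forall>b\<in>A. {a, b} \<in> T \<longrightarrow> (\<forall>p\<in>common_edge v a b. h a p = h b p)) \<and>
     (\<forall>a\<in>A. \<forall>b\<in>A. a \<noteq> b \<longrightarrow> interior (h a ` face v a) \<inter> interior (h b ` face v b) = {})"

text \<open>A net is given by its dual graph \<open>T\<close>: the edges of the octahedron that are not cut.\<close>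

definition is_net :: "(nat set \<Rightarrow> real^3) \<Rightarrow> nat set set \<Rightarrow> bool" where
  "is_net v T \<longleftrightarrow> spanning_tree T \<and> (\<exists>h. planar_layout v {1..8} T h)"

text \<open>A landscape is given by its faces, listed from origin to destination.\<close>

definition is_landscape :: "(nat set \<Rightarrow> real^3) \<Rightarrow> nat list \<Rightarrow> bool" where
  "is_landscape v L \<longleftrightarrow> 2 \<le> length L \<and> (\<exists>T. is_net v T \<and> is_path T L)"

text \<open>
  A point of a landscape is a point together with a face of the landscape containing it. The
  planar layout of a landscape is unique up to rigid motion, so the choice of \<open>h\<close> is immaterial.
\<close>

definition trail_length ::
    "(nat set \<Rightarrow> real^3) \<Rightarrow> nat list \<Rightarrow> nat \<times> (real^3) \<Rightarrow> nat \<times> (real^3) \<Rightarrow> ereal" where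
  "trail_length v L q1 q2 =
     (let h = (SOME h. planar_layout v (set L) (path_edges L) h);
          z1 = h (fst q1) (snd q1);
          z2 = h (fst q2) (snd q2)
      in if closed_segment z1 z2 \<subseteq> (\<Union>a\<in>set L. h a ` face v a)
         then ereal (dist z1 z2) else \<infinity>)"

end

theory Submission
  imports Defs
begin

text \<open>
  An admissible labelling permutes the vertex names, hence comes from a rotation of the octahedron,
  so one may assume that it is the identity. Unfolding the faces 1, 2, 5 around their common vertex
  gives half of a regular hexagon. It is convex, so the trail is a straight segment, and its length
  is computed from barycentric coordinates, on which every flat placement is affine. The half-turn
  about that vertex exchanges 1 with 5 and 2 with 6; it turns the formula for the faces 1, 2, 5 into
  the one for 5, 6, 1. That the three faces are part of a net is seen from an explicit net whose dual
  graph is the Hamiltonian path 1, 2, 5, 6, 7, 4, 3, 8.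
\<close>

section \<open>Flat placements of equilateral triangles\<close>

text \<open>The rotation is realised by renaming, not by moving points: composing \<open>v\<close>
  with the image map of the labelling gives a placement \<open>w\<close> of the same solid in which
  face \<open>n a\<close> is called \<open>a\<close>, so the geometry can speak of concrete labels.
  The clockwise clause makes \<open>w\<close> satisfy \<open>unit_octahedron\<close> rather than its
  mirror image. Flat placements are arbitrary functions constrained only on one face, and
  \<open>trail_length\<close> takes an unspecified layout, so the length has to be computed for
  every layout of the three faces. Rigidity makes this possible: the image of one oriented edge
  determines the third vertex by a rotation through 60 degrees, hence a glued layout is fixed by a
  base point and one unit vector, and both drop out of the distance. The net serves twice: it
  witnesses the landscape, and its layout shows that the unspecified choice is a genuine
  layout.\<close>

lemma dist_preserving_affine:
  fixes g :: "'a::real_inner \<Rightarrow> 'b::real_inner"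
  assumes iso: "\<And>p q. p \<in> X \<Longrightarrow> q \<in> X \<Longrightarrow> dist (g p) (g q) = dist p q"
    and X: "P \<in> X" "Q \<in> X" "R \<in> X" "P + \<beta> *\<^sub>R (Q - P) + \<gamma> *\<^sub>R (R - P) \<in> X"
  shows "g (P + \<beta> *\<^sub>R (Q - P) + \<gamma> *\<^sub>R (R - P)) = g P + \<beta> *\<^sub>R (g Q - g P) + \<gamma> *\<^sub>R (g R - g P)"
proof -
  define x where "x = P + \<beta> *\<^sub>R (Q - P) + \<gamma> *\<^sub>R (R - P)"
  have inner: "(g p - g P) \<bullet> (g q - g P) = (p - P) \<bullet> (q - P)" if "p \<in> X" "q \<in> X" for p q
    using iso[OF that(1) X(1)] iso[OF that(2) X(1)] iso[OF that]
    by (simp add: dot_norm_neg dist_norm)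
  let ?E = "(g x - g P) - \<beta> *\<^sub>R (g Q - g P) - \<gamma> *\<^sub>R (g R - g P)"
  let ?e = "(x - P) - \<beta> *\<^sub>R (Q - P) - \<gamma> *\<^sub>R (R - P)"
  have xX: "x \<in> X" using X by (simp add: x_def)
  have "?E \<bullet> ?E = ?e \<bullet> ?e"
    \<comment> \<open>The instantiated patterns expand only the outer differences and leave
      \<open>g p - g P\<close> whole, so that \<open>inner\<close> applies to every term.\<close>
    unfolding inner_diff_left[of "_ - _ *\<^sub>R _"] inner_diff_right[of _ "_ - _ *\<^sub>R _"]
      inner_diff_left[of _ "_ *\<^sub>R _"] inner_diff_right[of _ _ "_ *\<^sub>R _"] inner_scaleR_left inner_scaleR_right
    by (simp only: inner xX X)
  also have "\<dots> = 0" by (simp add: x_def)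
  finally have "?E = 0" by simp
  then show ?thesis unfolding x_def[symmetric] by (simp add: algebra_simps)
qed

definition rot60 :: "real \<times> real \<Rightarrow> real \<times> real" where
  "rot60 z = (fst z / 2 - sqrt 3 / 2 * snd z, sqrt 3 / 2 * fst z + snd z / 2)"

lemma norm_real_pair: "norm z = sqrt ((fst z)\<^sup>2 + (snd z)\<^sup>2)" for z :: "real \<times> real"
  by (simp add: norm_prod_def)

text \<open>A unit vector and its dot and cross products with a second vector determine the second
  one, as in complex multiplication. The dot product is 1/2 by polarization; Lagrange's identity
  gives the square of the cross product, and the orientation gives its sign.\<close>

lemma equilateral_ccw_third_vertex:
  assumes "dist p q = 1" "dist q r = 1" "dist p r = 1" "0 < plane_orientation p q r"
  shows "r - p = rot60 (q - p)"
proof -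
  define a b s t where "a = fst (q - p)" and "b = snd (q - p)" and "s = fst (r - p)" and "t = snd (r - p)"
  have 1: "a\<^sup>2 + b\<^sup>2 = 1" using assms(1)
    by (simp add: a_def b_def dist_norm norm_real_pair power2_commute)
  have 2: "s\<^sup>2 + t\<^sup>2 = 1" using assms(3)
    by (simp add: s_def t_def dist_norm norm_real_pair power2_commute)
  have 3: "(s - a)\<^sup>2 + (t - b)\<^sup>2 = 1" using assms(2)
    by (simp add: a_def b_def s_def t_def dist_norm norm_real_pair power2_commute)
  have dot: "a * s + b * t = 1/2" using 1 2 3 by (simp add: power2_diff algebra_simps)
  have pos: "0 < a * t - b * s"
    using assms(4) by (simp add: plane_orientation_def a_def b_def s_def t_def)
  have "(a * t - b * s)\<^sup>2 = (a\<^sup>2 + b\<^sup>2) * (s\<^sup>2 + t\<^sup>2) - (a * s + b * t)\<^sup>2"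
    by (simp add: power2_eq_square algebra_simps)
  also have "\<dots> = (sqrt 3 / 2)\<^sup>2" unfolding 1 2 dot by (simp add: power_divide)
  finally have cross: "a * t - b * s = sqrt 3 / 2"
    using pos by simp
  have "s = a * (a * s + b * t) - b * (a * t - b * s)"
    using arg_cong[OF 1, of "\<lambda>z. z * s"] by (simp add: power2_eq_square algebra_simps)
  moreover have "t = b * (a * s + b * t) + a * (a * t - b * s)"
    using arg_cong[OF 1, of "\<lambda>z. z * t"] by (simp add: power2_eq_square algebra_simps)
  ultimately have "s = a / 2 - sqrt 3 / 2 * b" "t = sqrt 3 / 2 * a + b / 2"
    unfolding dot cross by (simp_all add: algebra_simps)
  then show ?thesis
    by (simp add: rot60_def prod_eq_iff a_def b_def s_def t_def)
qed

section \<open>Faces as counterclockwise triangles and their placements\<close>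

definition ccw_triangle :: "(nat set \<Rightarrow> real^3) \<Rightarrow> nat \<Rightarrow> real^3 \<Rightarrow> real^3 \<Rightarrow> real^3 \<Rightarrow> bool" where
  "ccw_triangle v a P Q R \<longleftrightarrow> face v a = convex hull {P, Q, R} \<and>
     dist P Q = 1 \<and> dist Q R = 1 \<and> dist P R = 1 \<and> 0 < outside_orientation v a P Q R"

lemma outside_orientation_rotate: "outside_orientation v a Q R P = outside_orientation v a P Q R"
proof -
  have "cross3 (R - Q) (P - Q) = cross3 (Q - P) (R - P)"
    by (simp add: cross3_simps)
  then show ?thesis by (simp add: outside_orientation_def)
qed

lemma ccw_triangle_rotate: "ccw_triangle v a P Q R \<Longrightarrow> ccw_triangle v a Q R P"
  by (simp add: ccw_triangle_def outside_orientation_rotate dist_commute insert_commute)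

lemma ccw_triangle_vertices:
  assumes "ccw_triangle v a P Q R"
  shows "P \<in> face v a" "Q \<in> face v a" "R \<in> face v a"
  using assms by (auto simp: ccw_triangle_def intro: hull_inc)

lemma ccw_triangle_points:
  assumes "ccw_triangle v a P Q R"
  shows "face v a = {P + \<beta> *\<^sub>R (Q - P) + \<gamma> *\<^sub>R (R - P) |\<beta> \<gamma>. 0 \<le> \<beta> \<and> 0 \<le> \<gamma> \<and> \<beta> + \<gamma> \<le> 1}"
  using assms by (simp add: ccw_triangle_def convex_hull_3_alt)

lemma flat_placement_affine:
  assumes g: "flat_placement v a g" and t: "ccw_triangle v a P Q R"
    and "0 \<le> \<beta>" "0 \<le> \<gamma>" "\<beta> + \<gamma> \<le> 1"
  shows "g (P + \<beta> *\<^sub>R (Q - P) + \<gamma> *\<^sub>R (R - P)) = g P + \<beta> *\<^sub>R (g Q - g P) + \<gamma> *\<^sub>R (g R - g P)"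
proof (rule dist_preserving_affine[where X = "face v a"])
  show "P + \<beta> *\<^sub>R (Q - P) + \<gamma> *\<^sub>R (R - P) \<in> face v a"
    unfolding ccw_triangle_points[OF t] using assms by blast
qed (use g t in \<open>auto simp: flat_placement_def ccw_triangle_vertices\<close>)

lemma flat_placement_image:
  assumes g: "flat_placement v a g" and t: "ccw_triangle v a P Q R"
  shows "g ` face v a = {g P + \<beta> *\<^sub>R (g Q - g P) + \<gamma> *\<^sub>R (g R - g P) |\<beta> \<gamma>.
           0 \<le> \<beta> \<and> 0 \<le> \<gamma> \<and> \<beta> + \<gamma> \<le> 1}" (is "_ = ?T")
proof
  show "g ` face v a \<subseteq> ?T"
    unfolding ccw_triangle_points[OF t] using flat_placement_affine[OF g t] by fastforce
  show "?T \<subseteq> g ` face v a"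
  proof
    fix z assume "z \<in> ?T"
    then obtain \<beta> \<gamma> where *: "0 \<le> \<beta>" "0 \<le> \<gamma>" "\<beta> + \<gamma> \<le> 1"
      "z = g P + \<beta> *\<^sub>R (g Q - g P) + \<gamma> *\<^sub>R (g R - g P)" by blast
    then have "z = g (P + \<beta> *\<^sub>R (Q - P) + \<gamma> *\<^sub>R (R - P))"
      using flat_placement_affine[OF g t] by simp
    moreover have "P + \<beta> *\<^sub>R (Q - P) + \<gamma> *\<^sub>R (R - P) \<in> face v a"
      unfolding ccw_triangle_points[OF t] using * by blast
    ultimately show "z \<in> g ` face v a" by blast
  qed
qed

lemma flat_placement_edge:
  assumes g: "flat_placement v a g" and t: "ccw_triangle v a P Q R"
  shows "0 \<le> \<beta> \<Longrightarrow> \<beta> \<le> 1 \<Longrightarrow> g ((1 - \<beta>) *\<^sub>R P + \<beta> *\<^sub>R Q) = (1 - \<beta>) *\<^sub>R g P + \<beta> *\<^sub>R g Q"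
  using flat_placement_affine[OF g t, of \<beta> 0] by (simp add: algebra_simps)

lemma flat_placement_vertices:
  assumes g: "flat_placement v a g" and t: "ccw_triangle v a P Q R"
  shows "dist (g P) (g Q) = 1" "dist (g Q) (g R) = 1" "dist (g P) (g R) = 1"
    "0 < plane_orientation (g P) (g Q) (g R)" "g R - g P = rot60 (g Q - g P)"
proof -
  note ccw_triangle_vertices[OF t]
  then show "dist (g P) (g Q) = 1" "dist (g Q) (g R) = 1" "dist (g P) (g R) = 1"
    "0 < plane_orientation (g P) (g Q) (g R)"
    using g t by (simp_all add: flat_placement_def ccw_triangle_def)
  then show "g R - g P = rot60 (g Q - g P)"
    by (rule equilateral_ccw_third_vertex)
qed

text \<open>The placement in a representation is forced on the three vertices, so the pair
  \<open>(x, y)\<close> is a linear change of the barycentric coordinates with respect to the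
  reference edge.\<close>

lemma ccw_triangle_representation:
  assumes t: "ccw_triangle v a P Q R" and e: "common_edge v a b = convex hull {P, Q}"
    and rep: "is_representation v p a b x y"
  obtains \<beta> \<gamma> where "0 \<le> \<beta>" "0 \<le> \<gamma>" "\<beta> + \<gamma> \<le> 1" "p = P + \<beta> *\<^sub>R (Q - P) + \<gamma> *\<^sub>R (R - P)"
    "x = \<beta> + \<gamma> / 2" "y = sqrt 3 / 2 * \<gamma>"
proof -
  obtain g where p: "p \<in> face v a" and g: "flat_placement v a g"
    and up: "g ` face v a \<subseteq> {z. 0 \<le> snd z}"
    and seg: "g ` common_edge v a b = closed_segment (0, 0) (1, 0)" and gp: "g p = (x, y)"
    using rep unfolding is_representation_def by blast
  obtain \<beta> \<gamma> where bg: "0 \<le> \<beta>" "0 \<le> \<gamma>" "\<beta> + \<gamma> \<le> 1" "p = P + \<beta> *\<^sub>R (Q - P) + \<gamma> *\<^sub>R (R - P)"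
    using p unfolding ccw_triangle_points[OF t] by blast
  have "g ` closed_segment P Q = closed_segment (g P) (g Q)"
    using flat_placement_edge[OF g t] by (auto simp: closed_segment_image_interval image_image)
  then have "closed_segment (g P) (g Q) = closed_segment (0, 0) (1, 0)"
    using seg e by (simp add: segment_convex_hull)
  then have "{g P, g Q} = {(0, 0), (1, 0)}"
    by (simp only: closed_segment_eq)
  then have "g P = (0, 0) \<and> g Q = (1, 0) \<or> g P = (1, 0) \<and> g Q = (0, 0)"
    by (auto simp: doubleton_eq_iff)
  moreover have gR: "g R = g P + rot60 (g Q - g P)"
    using flat_placement_vertices(5)[OF g t] by (simp add: algebra_simps)
  \<comment> \<open>If \<open>P\<close> and \<open>Q\<close> went to the endpoints in the other
    order, \<open>g R\<close> would have ordinate \<open>- sqrt 3 / 2\<close>; this excludes the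
    reversed edge.\<close>
  moreover have "0 \<le> snd (g R)"
    using up ccw_triangle_vertices(3)[OF t] by auto
  ultimately have "g P = (0, 0)" "g Q = (1, 0)"
    by (auto simp: rot60_def)
  with gR have "g p = (\<beta> + \<gamma> / 2, sqrt 3 / 2 * \<gamma>)"
    unfolding bg(4) flat_placement_affine[OF g t bg(1-3)] by (simp add: rot60_def)
  with gp bg that show thesis by simp
qed

text \<open>Barycentric coordinates with respect to \<open>P, Q, R\<close> are reused with respect
  to \<open>p, q, r\<close>. Both triangles have the same Gram matrix, so distances are
  kept.\<close>

lemma flat_placement_exists:
  assumes t: "ccw_triangle v a P Q R"
    and u: "dist p q = 1" "dist q r = 1" "dist p r = 1" "0 < plane_orientation p q r"
  shows "\<exists>g. flat_placement v a g \<and> g P = p \<and> g Q = q \<and> g R = r"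
proof -
  define s t where "s = Q - P" and "t = R - P"
  have d: "dist P Q = 1" "dist Q R = 1" "dist P R = 1" and or: "0 < outside_orientation v a P Q R"
    using t by (simp_all add: ccw_triangle_def)
  have half: "norm (Q - P) = 1 \<and> norm (R - P) = 1 \<and> (Q - P) \<bullet> (R - P) = 1/2"
    if "dist P Q = 1" "dist Q R = 1" "dist P R = 1" for P Q R :: "'a::real_inner"
    using that dot_norm_neg[of "Q - P" "R - P"] by (simp add: dist_norm norm_minus_commute)
  have st: "s \<bullet> s = 1" "t \<bullet> t = 1" "s \<bullet> t = 1/2" "t \<bullet> s = 1/2"
    using half[OF d] by (simp_all add: s_def t_def dot_square_norm inner_commute)
  define s' t' where "s' = q - p" and "t' = r - p"
  have st': "s' \<bullet> s' = 1" "t' \<bullet> t' = 1" "s' \<bullet> t' = 1/2" "t' \<bullet> s' = 1/2"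
    using half[OF u(1-3)] by (simp_all add: s'_def t'_def dot_square_norm inner_commute)
  \<comment> \<open>The coefficients solve the Gram system of \<open>s, t\<close>, whose matrix is \<open>((1, 1/2), (1/2, 1))\<close>.\<close>
  define \<beta> \<gamma> where "\<beta> x = 4/3 * ((x - P) \<bullet> s - (x - P) \<bullet> t / 2)"
    and "\<gamma> x = 4/3 * ((x - P) \<bullet> t - (x - P) \<bullet> s / 2)" for x
  define g where "g x = p + \<beta> x *\<^sub>R s' + \<gamma> x *\<^sub>R t'" for x
  \<comment> \<open>This needs points of the face: off its plane, \<open>\<beta>\<close> and
    \<open>\<gamma>\<close> only describe the orthogonal projection.\<close>
  have diff: "y - x = (\<beta> y - \<beta> x) *\<^sub>R s + (\<gamma> y - \<gamma> x) *\<^sub>R t" if "x \<in> face v a" "y \<in> face v a" for x y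
  proof -
    have "x = P + \<beta> x *\<^sub>R s + \<gamma> x *\<^sub>R t" if x: "x \<in> face v a" for x
    proof -
      obtain b c where "x = P + b *\<^sub>R s + c *\<^sub>R t"
        using x unfolding ccw_triangle_points[OF \<open>ccw_triangle v a P Q R\<close>] s_def t_def by blast
      moreover from this have "\<beta> x = b" "\<gamma> x = c"
        by (simp_all add: \<beta>_def \<gamma>_def inner_add_left st field_simps)
      ultimately show ?thesis by simp
    qed
    from this[OF that(1)] this[OF that(2)] show ?thesis
      by (metis (no_types, opaque_lifting) add_diff_add add_diff_cancel_left scaleR_left_diff_distrib)
  qed
  have gdiff: "g y - g x = (\<beta> y - \<beta> x) *\<^sub>R s' + (\<gamma> y - \<gamma> x) *\<^sub>R t'" for x y
    by (simp add: g_def algebra_simps)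
  have "flat_placement v a g"
    unfolding flat_placement_def
  proof (intro conjI ballI)
    fix x y assume xy: "x \<in> face v a" "y \<in> face v a"
    have "(b *\<^sub>R s + c *\<^sub>R t) \<bullet> (b *\<^sub>R s + c *\<^sub>R t) = (b *\<^sub>R s' + c *\<^sub>R t') \<bullet> (b *\<^sub>R s' + c *\<^sub>R t')" for b c
      by (simp add: inner_add_left inner_add_right st st')
    then show "dist (g x) (g y) = dist x y"
      unfolding dist_norm norm_eq gdiff diff[OF xy(2,1)] by simp
  next
    fix x y z assume xyz: "x \<in> face v a" "y \<in> face v a" "z \<in> face v a"
    \<comment> \<open>The determinant of the coordinates of \<open>y - x\<close> and
      \<open>z - x\<close>. It scales the orientation of the reference triangle both in space and in
      the plane, so the two signs agree.\<close>
    define D where "D = (\<beta> y - \<beta> x) * (\<gamma> z - \<gamma> x) - (\<gamma> y - \<gamma> x) * (\<beta> z - \<beta> x)"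
    have "cross3 (b *\<^sub>R s + c *\<^sub>R t) (b' *\<^sub>R s + c' *\<^sub>R t) = (b * c' - c * b') *\<^sub>R cross3 s t" for b c b' c'
      by (simp add: cross3_simps)
    then have 1: "outside_orientation v a x y z = D * outside_orientation v a P Q R"
      unfolding outside_orientation_def diff[OF xyz(1,2)] diff[OF xyz(1,3)] s_def[symmetric] t_def[symmetric]
      by (simp add: D_def)
    have y: "fst (g y) - fst (g x) = (\<beta> y - \<beta> x) * fst s' + (\<gamma> y - \<gamma> x) * fst t'"
        "snd (g y) - snd (g x) = (\<beta> y - \<beta> x) * snd s' + (\<gamma> y - \<gamma> x) * snd t'" for y
      using arg_cong[OF gdiff[of y x], of fst] arg_cong[OF gdiff[of y x], of snd] by simp_all
    have o: "plane_orientation p q r = fst s' * snd t' - snd s' * fst t'"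
      by (simp add: plane_orientation_def s'_def t'_def)
    have 2: "plane_orientation (g x) (g y) (g z) = D * plane_orientation p q r"
      unfolding o unfolding plane_orientation_def y D_def by (simp add: algebra_simps)
    show "0 < outside_orientation v a x y z \<longleftrightarrow> 0 < plane_orientation (g x) (g y) (g z)"
      unfolding 1 2 using or u(4) by (simp add: zero_less_mult_iff)
  qed
  moreover have "g P = p" "g Q = q" "g R = r"
    by (simp_all add: g_def \<beta>_def \<gamma>_def s'_def t'_def st flip: s_def t_def)
  ultimately show ?thesis by blast
qed

section \<open>Combinatorics of the octahedron\<close>

lemma Collect_mem_insert:
  "{S \<in> insert X V. P S} = (if P X then insert X {S \<in> V. P S} else {S \<in> V. P S})"
  by auto

text \<open>Sums over explicit sets of vertex names need all pairwise inequalities; one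
  \<open>distinct\<close> list carries them together.\<close>

lemma oct_vertices_distinct:
  "distinct [{1,4,6,7}, {1,2,5,6}, {1,2,3,4}, {2,3,5,8}, {3,4,7,8}, {5,6,7,8::nat}]"
  by (simp add: set_eq_iff) (intro conjI; presburger)

lemmas oct_vertex_neq = oct_vertices_distinct[simplified distinct.simps list.set insert_iff de_Morgan_disj]

lemma oct_vertices_of_face:
  "{S \<in> oct_vertices. 1 \<in> S} = {{1,4,6,7}, {1,2,5,6}, {1,2,3,4}}"
  "{S \<in> oct_vertices. 2 \<in> S} = {{1,2,5,6}, {1,2,3,4}, {2,3,5,8}}"
  "{S \<in> oct_vertices. 3 \<in> S} = {{1,2,3,4}, {2,3,5,8}, {3,4,7,8}}"
  "{S \<in> oct_vertices. 4 \<in> S} = {{1,4,6,7}, {1,2,3,4}, {3,4,7,8}}"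
  "{S \<in> oct_vertices. 5 \<in> S} = {{1,2,5,6}, {2,3,5,8}, {5,6,7,8}}"
  "{S \<in> oct_vertices. 6 \<in> S} = {{1,4,6,7}, {1,2,5,6}, {5,6,7,8}}"
  "{S \<in> oct_vertices. 7 \<in> S} = {{1,4,6,7}, {3,4,7,8}, {5,6,7,8}}"
  "{S \<in> oct_vertices. 8 \<in> S} = {{2,3,5,8}, {3,4,7,8}, {5,6,7,8}}"
  unfolding oct_vertices_def Collect_mem_insert by simp_all

lemma oct_vertex_subset: "S \<in> oct_vertices \<Longrightarrow> S \<subseteq> {1..8}"
  by (auto simp: oct_vertices_def)

lemma atLeast1AtMost8: "{1..8} = {1,2,3,4,5,6,7,8::nat}"
  by auto

lemma adjacent_range: "adjacent a b \<Longrightarrow> a \<in> {1..8} \<and> b \<in> {1..8}"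
proof -
  assume "adjacent a b"
  then have "{S \<in> oct_vertices. a \<in> S \<and> b \<in> S} \<noteq> {}" by (auto simp: adjacent_def simp del: Collect_empty_eq)
  then show ?thesis using oct_vertex_subset by blast
qed

text \<open>Reduces adjacency and opposition of concrete labels to adding six truth values.\<close>

lemma card_oct_vertices_filter:
  "card {S \<in> oct_vertices. P S} = of_bool (P {1,4,6,7}) + (of_bool (P {1,2,5,6}) +
     (of_bool (P {1,2,3,4}) + (of_bool (P {2,3,5,8}) + (of_bool (P {3,4,7,8}) + of_bool (P {5,6,7,8})))))"
proof -
  have "card {S \<in> oct_vertices. P S} = (\<Sum>S\<in>oct_vertices. of_bool (P S))"
    by (simp add: sum.inter_filter[symmetric] of_bool_def oct_vertices_def del: One_nat_def)
  then show ?thesis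
    unfolding oct_vertices_def by (simp add: oct_vertex_neq del: One_nat_def)
qed

text \<open>The 24 pairs are the 12 edges of the octahedron, each in both orders.\<close>

lemma adjacent_iff:
  "adjacent a b \<longleftrightarrow> (a, b) \<in>
     {(1,2),(1,4),(1,6),(2,1),(2,3),(2,5),(3,2),(3,4),(3,8),(4,1),(4,3),(4,7),
      (5,2),(5,6),(5,8),(6,1),(6,5),(6,7),(7,4),(7,6),(7,8),(8,3),(8,5),(8,7)}" (is "_ \<longleftrightarrow> _ \<in> ?E")
proof (cases "a \<in> {1..8} \<and> b \<in> {1..8}")
  case True
  then have "a \<in> {1,2,3,4,5,6,7,8}" "b \<in> {1,2,3,4,5,6,7,8}"
    unfolding atLeast1AtMost8 by simp_all
  then show ?thesis
    by (elim insertE emptyE; hypsubst) (simp_all add: adjacent_def card_oct_vertices_filter)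
next
  case False
  then have "\<not> adjacent a b" using adjacent_range by blast
  moreover have "(a, b) \<notin> ?E"
    using False by (rule contrapos_nn) (elim insertE emptyE; simp)
  ultimately show ?thesis by (simp only: simp_thms)
qed

lemma adjacent_commute: "adjacent a b \<Longrightarrow> adjacent b a"
  by (metis (no_types, lifting) Collect_cong adjacent_def)

lemma opposite_sum:
  assumes "opposite a b"
  shows "b = 9 - a"
proof -
  have card: "card {S \<in> oct_vertices. a \<in> S \<and> b \<in> S} = 0"
    using assms by (simp only: opposite_def card.empty)
  have "a \<in> {1,2,3,4,5,6,7,8}" "b \<in> {1,2,3,4,5,6,7,8}"
    using assms unfolding atLeast1AtMost8 opposite_def by simp_all
  then show ?thesis
    using card unfolding card_oct_vertices_filter by (elim insertE emptyE; hypsubst) simp_all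
qed

text \<open>Antipodal vertices lie on complementary sets of faces.\<close>

lemma oct_vertex_complement: "S \<in> oct_vertices \<Longrightarrow> {1..8} - S \<in> oct_vertices"
  unfolding atLeast1AtMost8 oct_vertices_def
  by (elim insertE emptyE; hypsubst) (simp_all add: insert_Diff_if)

text \<open>The vertex of \<open>x\<close> away from its edge with \<open>c\<close> lies on
  \<open>a\<close>, on \<open>b\<close> and, not being on \<open>c\<close>, on the face opposite to
  \<open>c\<close>.\<close>

lemma three_neighbours_vertex:
  assumes "adjacent x a" "adjacent x b" "adjacent x c" "a \<noteq> b" "a \<noteq> c" "b \<noteq> c"
  shows "{x, a, b, 9 - c} \<in> oct_vertices"
proof -
  have "x \<in> {1,2,3,4,5,6,7,8}"
    using adjacent_range[OF assms(1)] unfolding atLeast1AtMost8 by simp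
  then show ?thesis
    using assms unfolding adjacent_iff oct_vertices_def
    by (elim insertE[of x] emptyE; hypsubst; simp del: One_nat_def) (elim disjE; simp add: insert_commute)+
qed


section \<open>Relabelings\<close>

text \<open>The label permutations induced by symmetries of the octahedron, reflections
  included.\<close>

definition octahedral_relabeling :: "(nat \<Rightarrow> nat) \<Rightarrow> bool" where
  "octahedral_relabeling n \<longleftrightarrow> bij_betw n {1..8} {1..8} \<and> (\<forall>S\<in>oct_vertices. n ` S \<in> oct_vertices)"

text \<open>The three neighbours of face \<open>n 1\<close> determine the names of its three
  vertices; the remaining vertices are antipodal to these, so their names are the
  complements.\<close>

lemma admissible_labeling_octahedral:
  assumes "admissible_labeling v n"
  shows "octahedral_relabeling n"
proof -
  have bij: "bij_betw n {1..8} {1..8}" using assms by (simp add: admissible_labeling_def)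
  then have inj: "inj_on n {1..8}" by (simp add: bij_betw_def)
  have adj: "adjacent (n 1) (n 2)" "adjacent (n 1) (n 4)" "adjacent (n 1) (n 6)"
    using assms by (simp_all add: admissible_labeling_def)
  have neq: "n 2 \<noteq> n 4" "n 2 \<noteq> n 6" "n 4 \<noteq> n 6"
    using inj by (simp_all add: inj_on_eq_iff)
  have opp: "n c = 9 - n b" if "b \<in> {1..8}" "c \<in> {1..8}" "b + c = 9" for b c
    using assms that opposite_sum unfolding admissible_labeling_def by blast
  have n: "n 7 = 9 - n 2" "n 5 = 9 - n 4" "n 3 = 9 - n 6"
    using opp[of 2 7] opp[of 4 5] opp[of 6 3] by simp_all
  have 1: "n ` {1,4,6,7} \<in> oct_vertices" "n ` {1,2,5,6} \<in> oct_vertices" "n ` {1,2,3,4} \<in> oct_vertices"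
    using three_neighbours_vertex[of "n 1" "n 4" "n 6" "n 2"]
      three_neighbours_vertex[of "n 1" "n 2" "n 6" "n 4"]
      three_neighbours_vertex[of "n 1" "n 2" "n 4" "n 6"] adj neq
    by (simp_all add: n insert_commute)
  have compl: "n ` ({1..8} - S) \<in> oct_vertices" if "n ` S \<in> oct_vertices" "S \<subseteq> {1..8}" for S
    using oct_vertex_complement[OF that(1)] inj_on_image_set_diff[OF inj Diff_subset that(2)] bij
    by (simp add: bij_betw_def)
  have 2: "n ` {2,3,5,8} \<in> oct_vertices" "n ` {3,4,7,8} \<in> oct_vertices" "n ` {5,6,7,8} \<in> oct_vertices"
    using compl[OF 1(1)] compl[OF 1(2)] compl[OF 1(3)] unfolding atLeast1AtMost8
    by (simp_all add: insert_Diff_if)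
  have "\<forall>S\<in>oct_vertices. n ` S \<in> oct_vertices"
    using 1 2 by (subst (1) oct_vertices_def) (simp only: ball_simps simp_thms)
  then show ?thesis
    using bij by (simp add: octahedral_relabeling_def)
qed

text \<open>Two namings of the same body: the face called \<open>a\<close> by \<open>w\<close> is
  the one called \<open>n a\<close> by \<open>v\<close>. The equations below move each notion from
  \<open>v\<close> to \<open>w\<close>.\<close>

locale relabeled_octahedron =
  fixes v w :: "nat set \<Rightarrow> real^3" and n :: "nat \<Rightarrow> nat"
  assumes n: "octahedral_relabeling n" and w: "\<And>S. w S = v (n ` S)"
begin

lemma n_bij: "bij_betw n {1..8} {1..8}"
  using n by (simp add: octahedral_relabeling_def)

lemma n_inj: "inj_on n {1..8}"
  using n_bij by (simp add: bij_betw_def)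

lemma n_range: "a \<in> {1..8} \<Longrightarrow> n a \<in> {1..8}"
  using n_bij by (auto simp: bij_betw_def)

lemma image_inj: "inj_on (image n) oct_vertices"
  using inj_on_image_eq_iff[OF n_inj] oct_vertex_subset by (simp add: inj_on_def)

lemma image_oct_vertices: "image n ` oct_vertices = oct_vertices"
  by (rule endo_inj_surj[OF _ _ image_inj])
    (use n in \<open>auto simp: octahedral_relabeling_def oct_vertices_def\<close>)

text \<open>All transfer equations rest on this: every notion is built from vertices selected by
  incidence, and \<open>n\<close> carries one selection onto the other.\<close>

lemma filter_image:
  assumes "\<And>S. S \<in> oct_vertices \<Longrightarrow> P' S \<longleftrightarrow> P (n ` S)"
  shows "{S \<in> oct_vertices. P S} = image n ` {S \<in> oct_vertices. P' S}"
proof -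
  have "{S \<in> oct_vertices. P S} = {S \<in> image n ` oct_vertices. P S}"
    by (simp add: image_oct_vertices)
  also have "\<dots> = image n ` {S \<in> oct_vertices. P' S}" using assms by blast
  finally show ?thesis .
qed

lemma mem_image: "a \<in> {1..8} \<Longrightarrow> S \<in> oct_vertices \<Longrightarrow> a \<in> S \<longleftrightarrow> n a \<in> n ` S"
  using inj_on_image_mem_iff[OF n_inj] oct_vertex_subset by blast

lemma face_eq: "a \<in> {1..8} \<Longrightarrow> face v (n a) = face w a"
  unfolding face_def by (subst filter_image[where P' = "\<lambda>S. a \<in> S"]) (simp_all add: mem_image image_image w)

lemma edge_vertices:
  "a \<in> {1..8} \<Longrightarrow> b \<in> {1..8} \<Longrightarrow>
    {S \<in> oct_vertices. n a \<in> S \<and> n b \<in> S} = image n ` {S \<in> oct_vertices. a \<in> S \<and> b \<in> S}"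
  by (rule filter_image) (simp add: mem_image)

lemma common_edge_eq:
  "a \<in> {1..8} \<Longrightarrow> b \<in> {1..8} \<Longrightarrow> common_edge v (n a) (n b) = common_edge w a b"
  unfolding common_edge_def by (simp add: edge_vertices image_image w)

lemma adjacent_eq: "a \<in> {1..8} \<Longrightarrow> b \<in> {1..8} \<Longrightarrow> adjacent (n a) (n b) \<longleftrightarrow> adjacent a b"
  unfolding adjacent_def edge_vertices
  using card_image[OF inj_on_subset[OF image_inj]] n_inj by (simp add: inj_on_eq_iff)

lemma oct_center_eq: "oct_center v = oct_center w"
  unfolding oct_center_def
  using sum.reindex[OF image_inj, of v] by (simp add: image_oct_vertices w o_def)

lemma face_center_eq: "a \<in> {1..8} \<Longrightarrow> face_center v (n a) = face_center w a"
  unfolding face_center_def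
  by (subst filter_image[where P' = "\<lambda>S. a \<in> S"])
    (simp_all add: mem_image sum.reindex[OF inj_on_subset[OF image_inj]] w)

lemma outside_orientation_eq: "a \<in> {1..8} \<Longrightarrow> outside_orientation v (n a) = outside_orientation w a"
  by (simp add: outside_orientation_def outward_normal_def oct_center_eq face_center_eq fun_eq_iff)

lemma flat_placement_eq: "a \<in> {1..8} \<Longrightarrow> flat_placement v (n a) = flat_placement w a"
  by (simp add: flat_placement_def face_eq outside_orientation_eq fun_eq_iff)

lemma clockwise_around_eq:
  "a \<in> {1..8} \<Longrightarrow> b \<in> {1..8} \<Longrightarrow> c \<in> {1..8} \<Longrightarrow> d \<in> {1..8} \<Longrightarrow>
    clockwise_around v (n a) (n b) (n c) (n d) \<longleftrightarrow> clockwise_around w a b c d"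
  by (simp add: clockwise_around_def face_center_eq outside_orientation_eq)

lemma is_representation_eq:
  "a \<in> {1..8} \<Longrightarrow> b \<in> {1..8} \<Longrightarrow> is_representation v p (n a) (n b) x y = is_representation w p a b x y"
  by (simp add: is_representation_def adjacent_eq face_eq flat_placement_eq common_edge_eq)

text \<open>Layout maps are indexed by labels, so passing to \<open>w\<close> reindexes
  \<open>h\<close> along \<open>n\<close>. The range conditions allow injectivity of
  \<open>n\<close>, lifted to sets of labels, to reflect membership in \<open>T\<close>.\<close>

lemma planar_layout_eq:
  assumes A: "A \<subseteq> {1..8}" and T: "\<Union>T \<subseteq> {1..8}"
  shows "planar_layout v (n ` A) (image n ` T) h \<longleftrightarrow> planar_layout w A T (h \<circ> n)"
proof -
  have AD: "a \<in> {1..8}" if "a \<in> A" for a using that A by blast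
  have T_iff: "{n a, n b} \<in> image n ` T \<longleftrightarrow> {a, b} \<in> T" if "a \<in> A" "b \<in> A" for a b
  proof -
    have inj: "inj_on (image n) (Pow {1..8})" by (rule inj_on_image_Pow[OF n_inj])
    have "{a, b} \<in> Pow {1..8}" "T \<subseteq> Pow {1..8}" using AD[OF that(1)] AD[OF that(2)] T by auto
    from inj_on_image_mem_iff[OF inj this] show ?thesis by simp
  qed
  have neq: "n a \<noteq> n b \<longleftrightarrow> a \<noteq> b" if "a \<in> A" "b \<in> A" for a b
    using inj_on_eq_iff[OF n_inj AD[OF that(1)] AD[OF that(2)]] by simp
  show ?thesis
    unfolding planar_layout_def ball_simps
    by (intro arg_cong2[of _ _ _ _ "(\<and>)"] ball_cong refl)
      (simp_all only: AD T_iff neq o_apply flat_placement_eq common_edge_eq face_eq)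
qed

end

section \<open>Faces in space\<close>

text \<open>The existential body of \<open>unit_octahedron\<close> with its witnesses as arguments,
  so that the axes can be named and replaced.\<close>

definition oct_frame :: "(nat set \<Rightarrow> real^3) \<Rightarrow> real^3 \<Rightarrow> real^3 \<Rightarrow> real^3 \<Rightarrow> real^3 \<Rightarrow> bool" where
  "oct_frame v c e1 e2 e3 \<longleftrightarrow>
     norm e1 = 1 \<and> norm e2 = 1 \<and> norm e3 = 1 \<and>
     e1 \<bullet> e2 = 0 \<and> e1 \<bullet> e3 = 0 \<and> e2 \<bullet> e3 = 0 \<and>
     v {1,4,6,7} = c + (1 / sqrt 2) *\<^sub>R e1 \<and> v {2,3,5,8} = c - (1 / sqrt 2) *\<^sub>R e1 \<and>
     v {1,2,5,6} = c + (1 / sqrt 2) *\<^sub>R e2 \<and> v {3,4,7,8} = c - (1 / sqrt 2) *\<^sub>R e2 \<and>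
     v {1,2,3,4} = c + (1 / sqrt 2) *\<^sub>R e3 \<and> v {5,6,7,8} = c - (1 / sqrt 2) *\<^sub>R e3"

lemma unit_octahedron_frame:
  "unit_octahedron v \<longleftrightarrow> (\<exists>c e1 e2 e3. oct_frame v c e1 e2 e3) \<and> clockwise_around v 1 2 4 6"
  by (simp add: unit_octahedron_def oct_frame_def)

lemma oct_frame_center:
  assumes "oct_frame v c e1 e2 e3"
  shows "oct_center v = c"
proof -
  have "(\<Sum>S\<in>oct_vertices. v S) = 6 *\<^sub>R c"
    using assms unfolding oct_vertices_def oct_frame_def
    by (simp add: oct_vertex_neq del: One_nat_def) (simp add: vec_eq_iff)
  then show ?thesis by (simp add: oct_center_def)
qed

text \<open>For signed axes, \<open>X + Y + Z\<close> points along the outward normal of the face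
  that they span; its orientation thus reduces to the determinant of the axes.\<close>

lemma triple_product_triangle:
  "(X + Y + Z) \<bullet> cross3 (Y - X) (Z - X) = 3 * (X \<bullet> cross3 Y Z)"
  by (simp add: cross3_simps)

text \<open>Negating \<open>e1\<close>, \<open>e2\<close>, \<open>e3\<close> in turn carries face 1
  to faces 2, 4, 6. The clockwise condition therefore says that the frame is left-handed.\<close>

lemma oct_frame_clockwise:
  assumes f: "oct_frame v c e1 e2 e3"
  shows "clockwise_around v 1 2 4 6 \<longleftrightarrow> e1 \<bullet> cross3 e2 e3 < 0"
proof -
  define k where "k = 1 / (3 * sqrt 2)"
  have k: "0 < k" by (simp add: k_def)
  have fc: "face_center v 1 = c + k *\<^sub>R (e1 + e2 + e3)" "face_center v 2 = c + k *\<^sub>R (- e1 + e2 + e3)"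
    "face_center v 4 = c + k *\<^sub>R (e1 - e2 + e3)" "face_center v 6 = c + k *\<^sub>R (e1 + e2 - e3)"
    using f unfolding face_center_def oct_vertices_of_face oct_frame_def k_def
    by (simp_all add: oct_vertex_neq del: One_nat_def)
      (simp_all add: vec_eq_iff field_simps)
  \<comment> \<open>Up to \<open>k\<close>, the triangle of centres is that of the axis tips,
    doubled and point-reflected; the sign cancels in the cross product and the factor 4
    remains.\<close>
  have "cross3 (e1 - e2 + e3 - (- e1 + e2 + e3)) (e1 + e2 - e3 - (- e1 + e2 + e3))
      = 4 *\<^sub>R cross3 (e2 - e1) (e3 - e1)"
    by (simp add: cross3_simps)
  moreover have "face_center v 4 - face_center v 2 = k *\<^sub>R (e1 - e2 + e3 - (- e1 + e2 + e3))"
    "face_center v 6 - face_center v 2 = k *\<^sub>R (e1 + e2 - e3 - (- e1 + e2 + e3))"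
    unfolding fc by (simp_all add: vec_eq_iff algebra_simps)
  ultimately have "outside_orientation v 1 (face_center v 2) (face_center v 4) (face_center v 6)
      = k * k * k * 4 * ((e1 + e2 + e3) \<bullet> cross3 (e2 - e1) (e3 - e1))"
    unfolding outside_orientation_def outward_normal_def oct_frame_center[OF f] fc(1)
    by (simp add: cross_mult_left cross_mult_right)
  also have "\<dots> = (k * k * k * 12) * (e1 \<bullet> cross3 e2 e3)"
    unfolding triple_product_triangle by simp
  finally show ?thesis
    using k by (simp add: clockwise_around_def mult_less_0_iff)
qed

text \<open>Stated for an arbitrary orthonormal triple so that each of the eight faces is an
  instance with suitably signed axes.\<close>

lemma orthonormal_face_ccw:
  assumes c: "oct_center v = c" and S: "{S \<in> oct_vertices. a \<in> S} = {S1, S2, S3}"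
    and V: "v S1 = c + (1 / sqrt 2) *\<^sub>R X1" "v S2 = c + (1 / sqrt 2) *\<^sub>R X2" "v S3 = c + (1 / sqrt 2) *\<^sub>R X3"
    and X: "norm X1 = 1" "norm X2 = 1" "norm X3 = 1" "X1 \<bullet> X2 = 0" "X1 \<bullet> X3 = 0" "X2 \<bullet> X3 = 0"
    and pos: "0 < X1 \<bullet> cross3 X2 X3"
  shows "ccw_triangle v a (v S1) (v S2) (v S3)"
proof -
  define k where "k = 1 / sqrt 2"
  have k: "0 < k" by (simp add: k_def)
  note V = V[folded k_def]
  have d: "dist (c + k *\<^sub>R X) (c + k *\<^sub>R Y) = 1" if "norm X = 1" "norm Y = 1" "X \<bullet> Y = 0" for X Y
  proof -
    have "dist (c + k *\<^sub>R X) (c + k *\<^sub>R Y) = norm (k *\<^sub>R (X - Y))"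
      by (simp add: dist_norm scaleR_diff_right)
    moreover have "(norm (X - Y))\<^sup>2 = 2"
      using that dot_norm_neg[of X Y] by simp
    then have "norm (X - Y) = sqrt 2" by (metis norm_ge_zero real_sqrt_unique)
    ultimately show ?thesis by (simp add: k_def)
  qed
  \<comment> \<open>Distinct directions force distinct names, so the sum defining the face centre
    really has three terms.\<close>
  have "S1 \<noteq> S2" "S1 \<noteq> S3" "S2 \<noteq> S3"
    using V X k by (auto simp: dot_square_norm)
  then have "face_center v a - c = (k / 3) *\<^sub>R (X1 + X2 + X3)"
    unfolding face_center_def S by (simp add: V vec_eq_iff field_simps)
  moreover have "v S2 - v S1 = k *\<^sub>R (X2 - X1)" "v S3 - v S1 = k *\<^sub>R (X3 - X1)"
    by (simp_all add: V scaleR_diff_right)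
  ultimately have "outside_orientation v a (v S1) (v S2) (v S3)
      = k * k * k / 3 * ((X1 + X2 + X3) \<bullet> cross3 (X2 - X1) (X3 - X1))"
    unfolding outside_orientation_def outward_normal_def c by (simp add: cross_mult_left cross_mult_right)
  also have "\<dots> = k * k * k * (X1 \<bullet> cross3 X2 X3)"
    unfolding triple_product_triangle by simp
  finally show ?thesis
    using d X k pos unfolding ccw_triangle_def by (simp add: V face_def S)
qed

text \<open>The frame is left-handed: signed axes in the order \<open>e1\<close>, \<open>e2\<close>,
  \<open>e3\<close> are positively oriented exactly for an odd number of minus signs. For the faces
  1, 3, 5, 7 the number is even and the last two vertices are swapped.\<close>

lemma unit_octahedron_faces:
  assumes "unit_octahedron v"
  shows "ccw_triangle v 1 (v {1,4,6,7}) (v {1,2,3,4}) (v {1,2,5,6})"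
    "ccw_triangle v 2 (v {2,3,5,8}) (v {1,2,5,6}) (v {1,2,3,4})"
    "ccw_triangle v 3 (v {2,3,5,8}) (v {1,2,3,4}) (v {3,4,7,8})"
    "ccw_triangle v 4 (v {1,4,6,7}) (v {3,4,7,8}) (v {1,2,3,4})"
    "ccw_triangle v 5 (v {2,3,5,8}) (v {5,6,7,8}) (v {1,2,5,6})"
    "ccw_triangle v 6 (v {1,4,6,7}) (v {1,2,5,6}) (v {5,6,7,8})"
    "ccw_triangle v 7 (v {1,4,6,7}) (v {5,6,7,8}) (v {3,4,7,8})"
    "ccw_triangle v 8 (v {2,3,5,8}) (v {3,4,7,8}) (v {5,6,7,8})"
proof -
  obtain c e1 e2 e3 where f: "oct_frame v c e1 e2 e3"
    using assms by (auto simp: unit_octahedron_frame)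
  have neg: "e1 \<bullet> cross3 e2 e3 < 0" "0 < e1 \<bullet> cross3 e3 e2"
    using assms oct_frame_clockwise[OF f] cross_skew[of e3 e2] by (simp_all add: unit_octahedron_frame)
  note ccw = orthonormal_face_ccw[OF oct_frame_center[OF f]]
  note F = f[unfolded oct_frame_def]
  show "ccw_triangle v 1 (v {1,4,6,7}) (v {1,2,3,4}) (v {1,2,5,6})"
    by (rule ccw[where ?X1.0 = e1 and ?X2.0 = e3 and ?X3.0 = e2], unfold oct_vertices_of_face)
      (use F neg in \<open>auto simp: inner_commute\<close>)
  show "ccw_triangle v 2 (v {2,3,5,8}) (v {1,2,5,6}) (v {1,2,3,4})"
    by (rule ccw[where ?X1.0 = "- e1" and ?X2.0 = e2 and ?X3.0 = e3], unfold oct_vertices_of_face)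
      (use F neg in \<open>auto simp: inner_commute\<close>)
  show "ccw_triangle v 3 (v {2,3,5,8}) (v {1,2,3,4}) (v {3,4,7,8})"
    by (rule ccw[where ?X1.0 = "- e1" and ?X2.0 = e3 and ?X3.0 = "- e2"], unfold oct_vertices_of_face)
      (use F neg in \<open>auto simp: inner_commute\<close>)
  show "ccw_triangle v 4 (v {1,4,6,7}) (v {3,4,7,8}) (v {1,2,3,4})"
    by (rule ccw[where ?X1.0 = e1 and ?X2.0 = "- e2" and ?X3.0 = e3], unfold oct_vertices_of_face)
      (use F neg in \<open>auto simp: inner_commute\<close>)
  show "ccw_triangle v 5 (v {2,3,5,8}) (v {5,6,7,8}) (v {1,2,5,6})"
    by (rule ccw[where ?X1.0 = "- e1" and ?X2.0 = "- e3" and ?X3.0 = e2], unfold oct_vertices_of_face)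
      (use F neg in \<open>auto simp: inner_commute\<close>)
  show "ccw_triangle v 6 (v {1,4,6,7}) (v {1,2,5,6}) (v {5,6,7,8})"
    by (rule ccw[where ?X1.0 = e1 and ?X2.0 = e2 and ?X3.0 = "- e3"], unfold oct_vertices_of_face)
      (use F neg in \<open>auto simp: inner_commute\<close>)
  show "ccw_triangle v 7 (v {1,4,6,7}) (v {5,6,7,8}) (v {3,4,7,8})"
    by (rule ccw[where ?X1.0 = e1 and ?X2.0 = "- e3" and ?X3.0 = "- e2"], unfold oct_vertices_of_face)
      (use F neg in \<open>auto simp: inner_commute\<close>)
  show "ccw_triangle v 8 (v {2,3,5,8}) (v {3,4,7,8}) (v {5,6,7,8})"
    by (rule ccw[where ?X1.0 = "- e1" and ?X2.0 = "- e2" and ?X3.0 = "- e3"], unfold oct_vertices_of_face)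
      (use F neg in \<open>auto simp: inner_commute\<close>)
qed

text \<open>The metric relations between vertices depend only on whether their names are equal,
  disjoint or overlapping, which a relabeling preserves.\<close>

lemma oct_frame_vertices:
  assumes f: "oct_frame v c e1 e2 e3" and S: "S \<in> oct_vertices"
  shows "(v S - c) \<bullet> (v S - c) = 1/2"
    and "S' \<in> oct_vertices \<Longrightarrow> S \<inter> S' = {} \<Longrightarrow> v S' - c = - (v S - c)"
    and "S' \<in> oct_vertices \<Longrightarrow> S \<inter> S' \<noteq> {} \<Longrightarrow> S \<noteq> S' \<Longrightarrow> (v S - c) \<bullet> (v S' - c) = 0"
proof -
  note F = f[unfolded oct_frame_def]
  note S' = S[unfolded oct_vertices_def]
  show "(v S - c) \<bullet> (v S - c) = 1/2"
    using S' by (elim insertE emptyE; hypsubst) (use F in \<open>simp_all add: dot_square_norm power_divide del: One_nat_def\<close>)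
  show "v S' - c = - (v S - c)" if "S' \<in> oct_vertices" "S \<inter> S' = {}"
    using S' that unfolding oct_vertices_def
    by (elim insertE emptyE; hypsubst) (use F in \<open>simp_all del: One_nat_def\<close>)
  show "(v S - c) \<bullet> (v S' - c) = 0" if "S' \<in> oct_vertices" "S \<inter> S' \<noteq> {}" "S \<noteq> S'"
    using S' that unfolding oct_vertices_def
    by (elim insertE emptyE; hypsubst) (use F in \<open>simp_all add: inner_commute del: One_nat_def\<close>)
qed

lemma (in relabeled_octahedron) unit_octahedron_relabel:
  assumes "unit_octahedron v" "clockwise_around w 1 2 4 6"
  shows "unit_octahedron w"
proof -
  obtain c e1 e2 e3 where f: "oct_frame v c e1 e2 e3"
    using assms by (auto simp: unit_octahedron_frame)
  have V: "n ` S \<in> oct_vertices" if "S \<in> oct_vertices" for S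
    using n that by (simp add: octahedral_relabeling_def)
  have disj: "n ` S \<inter> n ` S' = {} \<longleftrightarrow> S \<inter> S' = {}" "n ` S = n ` S' \<longleftrightarrow> S = S'"
    if "S \<in> oct_vertices" "S' \<in> oct_vertices" for S S'
    using inj_on_image_Int[OF n_inj oct_vertex_subset[OF that(1)] oct_vertex_subset[OF that(2)]]
      inj_on_eq_iff[OF image_inj that] by auto
  have W: "(w S - c) \<bullet> (w S - c) = 1/2" if "S \<in> oct_vertices" for S
    using oct_frame_vertices(1)[OF f V[OF that]] by (simp add: w)
  have opp: "w S' = c - (w S - c)" if "S \<in> oct_vertices" "S' \<in> oct_vertices" "S \<inter> S' = {}" for S S'
    using oct_frame_vertices(2)[OF f V[OF that(1)] V[OF that(2)]] disj[OF that(1,2)] that(3)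
    by (simp add: w algebra_simps)
  have orth: "(w S - c) \<bullet> (w S' - c) = 0"
    if "S \<in> oct_vertices" "S' \<in> oct_vertices" "S \<inter> S' \<noteq> {}" "S \<noteq> S'" for S S'
    using oct_frame_vertices(3)[OF f V[OF that(1)] V[OF that(2)]] disj[OF that(1,2)] that(3,4)
    by (simp add: w)
  have mem: "{1,4,6,7} \<in> oct_vertices" "{1,2,5,6} \<in> oct_vertices" "{1,2,3,4} \<in> oct_vertices"
    "{2,3,5,8} \<in> oct_vertices" "{3,4,7,8} \<in> oct_vertices" "{5,6,7,8} \<in> oct_vertices"
    by (simp_all only: oct_vertices_def insert_iff simp_thms)
  \<comment> \<open>The factor \<open>sqrt 2\<close> normalises, since the vertices have distance
    \<open>1 / sqrt 2\<close> from the centre.\<close>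
  define g where "g S = sqrt 2 *\<^sub>R (w S - c)" for S
  have norm_g: "norm (g S) = 1" if "S \<in> oct_vertices" for S
    unfolding norm_eq_1 g_def inner_scaleR_left inner_scaleR_right W[OF that] by simp
  have w_g: "w S = c + (1 / sqrt 2) *\<^sub>R g S" for S
    by (simp add: g_def)
  have "oct_frame w c (g {1,4,6,7}) (g {1,2,5,6}) (g {1,2,3,4})"
    unfolding oct_frame_def
  proof (intro conjI norm_g mem w_g)
    show "w {2,3,5,8} = c - (1 / sqrt 2) *\<^sub>R g {1,4,6,7}"
      using opp[OF mem(1,4)] by (simp add: g_def)
    show "w {3,4,7,8} = c - (1 / sqrt 2) *\<^sub>R g {1,2,5,6}"
      using opp[OF mem(2,5)] by (simp add: g_def)
    show "w {5,6,7,8} = c - (1 / sqrt 2) *\<^sub>R g {1,2,3,4}"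
      using opp[OF mem(3,6)] by (simp add: g_def)
    show "g {1,4,6,7} \<bullet> g {1,2,5,6} = 0"
      using orth[OF mem(1,2)] by (simp add: g_def oct_vertex_neq del: One_nat_def)
    show "g {1,4,6,7} \<bullet> g {1,2,3,4} = 0"
      using orth[OF mem(1,3)] by (simp add: g_def oct_vertex_neq del: One_nat_def)
    show "g {1,2,5,6} \<bullet> g {1,2,3,4} = 0"
      using orth[OF mem(2,3)] by (simp add: g_def oct_vertex_neq del: One_nat_def)
  qed
  with assms show ?thesis by (auto simp: unit_octahedron_frame)
qed

lemma common_edge_commute: "common_edge v a b = common_edge v b a"
  unfolding common_edge_def by (metis (no_types, lifting))

text \<open>The seven edges along which the net is glued; the first and the third are also the
  reference edges of the two representations.\<close>

lemma path_edge_endpoints: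
  "common_edge v 1 2 = convex hull {v {1,2,3,4}, v {1,2,5,6}}"
  "common_edge v 2 5 = convex hull {v {1,2,5,6}, v {2,3,5,8}}"
  "common_edge v 5 6 = convex hull {v {5,6,7,8}, v {1,2,5,6}}"
  "common_edge v 6 7 = convex hull {v {5,6,7,8}, v {1,4,6,7}}"
  "common_edge v 7 4 = convex hull {v {3,4,7,8}, v {1,4,6,7}}"
  "common_edge v 4 3 = convex hull {v {3,4,7,8}, v {1,2,3,4}}"
  "common_edge v 3 8 = convex hull {v {3,4,7,8}, v {2,3,5,8}}"
  unfolding common_edge_def oct_vertices_def Collect_mem_insert by (simp_all add: insert_commute)

text \<open>The half-turn about the axis through the vertex \<open>{1,2,5,6}\<close>.\<close>

definition rotate_labels :: "nat \<Rightarrow> nat" where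
  "rotate_labels k = (if k \<le> 4 then k + 4 else k - 4)"

lemma rotate_labels_octahedral: "octahedral_relabeling rotate_labels"
proof -
  have "bij_betw rotate_labels {1..8} {1..8}"
    by (rule bij_betw_byWitness[where f' = rotate_labels]) (auto simp: rotate_labels_def)
  moreover have "\<forall>S\<in>oct_vertices. rotate_labels ` S \<in> oct_vertices"
    unfolding oct_vertices_def by (simp add: rotate_labels_def insert_commute)
  ultimately show ?thesis by (simp add: octahedral_relabeling_def)
qed

lemma octahedral_relabeling_comp:
  assumes "octahedral_relabeling m" "octahedral_relabeling n"
  shows "octahedral_relabeling (n \<circ> m)"
  using assms unfolding octahedral_relabeling_def image_comp[symmetric]
  by (auto intro: bij_betw_trans)

text \<open>The half-turn reverses two of the three axes, so the handedness of the frame is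
  kept.\<close>

lemma unit_octahedron_rotate:
  assumes "unit_octahedron v"
  shows "unit_octahedron (\<lambda>S. v (rotate_labels ` S))"
proof -
  obtain c e1 e2 e3 where f: "oct_frame v c e1 e2 e3"
    using assms by (auto simp: unit_octahedron_frame)
  let ?w = "\<lambda>S. v (rotate_labels ` S)"
  have im: "rotate_labels ` {1,4,6,7} = {2,3,5,8}" "rotate_labels ` {2,3,5,8} = {1,4,6,7}"
    "rotate_labels ` {1,2,5,6} = {1,2,5,6}" "rotate_labels ` {3,4,7,8} = {3,4,7,8}"
    "rotate_labels ` {1,2,3,4} = {5,6,7,8}" "rotate_labels ` {5,6,7,8} = {1,2,3,4}"
    by (simp_all add: rotate_labels_def insert_commute)
  have f': "oct_frame ?w c (- e1) e2 (- e3)"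
    using f unfolding oct_frame_def im by simp
  have "e1 \<bullet> cross3 e2 e3 < 0"
    using assms oct_frame_clockwise[OF f] by (simp add: unit_octahedron_frame)
  then have "clockwise_around ?w 1 2 4 6"
    using oct_frame_clockwise[OF f'] by simp
  with f' show ?thesis by (auto simp: unit_octahedron_frame)
qed


section \<open>Trails through three faces\<close>

lemma rot60_minus: "rot60 (- z) = - rot60 z"
  by (simp add: rot60_def prod_eq_iff)

text \<open>The equation \<open>z^2 = z - 1\<close> of a primitive sixth root of unity.\<close>

lemma rot60_rot60: "rot60 (rot60 z) = rot60 z - z"
  by (simp add: rot60_def prod_eq_iff field_simps)

text \<open>The vector is resolved along \<open>z - rot60 z\<close>, of norm 1, and the orthogonal
  \<open>z + rot60 z\<close>, of norm \<open>sqrt 3\<close>. This splitting produces the two squares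
  of the distance formula.\<close>

lemma norm_lattice_combination:
  assumes "norm z = 1"
  shows "norm (a *\<^sub>R z - b *\<^sub>R rot60 z) = sqrt (((a + b) / 2)\<^sup>2 + (sqrt 3 / 2 * (a - b))\<^sup>2)"
proof -
  obtain s t where z: "z = (s, t)" by fastforce
  have 1: "s\<^sup>2 + t\<^sup>2 = 1" using assms by (simp add: z norm_real_pair)
  define r where "r = sqrt 3"
  have r: "r * r = 3" by (simp add: r_def)
  have "(a * s - b * (s / 2 - r / 2 * t))\<^sup>2 + (a * t - b * (r / 2 * s + t / 2))\<^sup>2
      = (a\<^sup>2 - a * b + b\<^sup>2 * (1 + r * r) / 4) * (s\<^sup>2 + t\<^sup>2)"
    by (simp add: power2_eq_square field_simps)
  also have "\<dots> = ((a + b) / 2)\<^sup>2 + (r * r) / 4 * (a - b)\<^sup>2"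
    unfolding 1 r by (simp add: power2_eq_square field_simps)
  also have "(r * r) / 4 * (a - b)\<^sup>2 = (r / 2 * (a - b))\<^sup>2"
    by (simp add: power2_eq_square)
  finally show ?thesis
    by (simp add: norm_real_pair z rot60_def r_def)
qed

text \<open>
  Three unit triangles around a common vertex \<open>b\<close> form half of a regular hexagon, which is convex.
\<close>

lemma half_hexagon_segment:
  assumes z: "z \<in> closed_segment (b + x1 *\<^sub>R u + y1 *\<^sub>R w) (b + x2 *\<^sub>R u + y2 *\<^sub>R w)"
    and "x1 \<le> 1" "y1 \<le> 1" "0 \<le> x1 + y1" "x1 + y1 \<le> 1"
    and "x2 \<le> 1" "y2 \<le> 1" "0 \<le> x2 + y2" "x2 + y2 \<le> 1"
  obtains x y where "x \<le> 1" "y \<le> 1" "0 \<le> x + y" "x + y \<le> 1" "z = b + x *\<^sub>R u + y *\<^sub>R w"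
proof -
  obtain t where t: "0 \<le> t" "t \<le> 1"
    "z = (1 - t) *\<^sub>R (b + x1 *\<^sub>R u + y1 *\<^sub>R w) + t *\<^sub>R (b + x2 *\<^sub>R u + y2 *\<^sub>R w)"
    using z by (auto simp: closed_segment_def)
  define x y where "x = (1 - t) * x1 + t * x2" and "y = (1 - t) * y1 + t * y2"
  have "x \<le> 1" "y \<le> 1"
    unfolding x_def y_def by (rule convex_bound_le; use t assms in simp)+
  moreover have "x + y = (1 - t) * (x1 + y1) + t * (x2 + y2)" by (simp add: x_def y_def algebra_simps)
  then have "0 \<le> x + y" "x + y \<le> 1"
    using t(1,2) assms by (auto intro!: convex_bound_le)
  moreover have "z = b + x *\<^sub>R u + y *\<^sub>R w"
    unfolding t(3) x_def y_def by (simp add: algebra_simps)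
  ultimately show thesis by (rule that)
qed

lemma layout_trail:
  assumes oct: "unit_octahedron v" and lay: "planar_layout v {1,2,5} {{1,2},{2,5}} h"
    and r1: "is_representation v p1 1 2 x1 y1" and r2: "is_representation v p2 5 6 x2 y2"
  shows "closed_segment (h 1 p1) (h 5 p2) \<subseteq> (\<Union>a\<in>{1,2,5}. h a ` face v a)"
    and "dist (h 1 p1) (h 5 p2) = sqrt (((1 - x1 + sqrt 3 * y1) / 2 - x2 + 1)\<^sup>2
                      + ((sqrt 3 - sqrt 3 * x1 - y1) / 2 - y2)\<^sup>2)"
proof -
  define A B C D F where "A = v {1,4,6,7}" and "B = v {1,2,5,6}" and "C = v {1,2,3,4}"
    and "D = v {2,3,5,8}" and "F = v {5,6,7,8}"
  note defs = A_def B_def C_def D_def F_def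
  have t1: "ccw_triangle v 1 A C B" and t2: "ccw_triangle v 2 D B C" and t5: "ccw_triangle v 5 D F B"
    using unit_octahedron_faces[OF oct] by (simp_all only: defs)
  note t1' = ccw_triangle_rotate[OF t1] and t1'' = ccw_triangle_rotate[OF ccw_triangle_rotate[OF t1]]
    and t2' = ccw_triangle_rotate[OF t2]
    and t5' = ccw_triangle_rotate[OF t5] and t5'' = ccw_triangle_rotate[OF ccw_triangle_rotate[OF t5]]
  note e = path_edge_endpoints(1-3)[of v, folded defs]
  have h: "flat_placement v 1 (h 1)" "flat_placement v 2 (h 2)" "flat_placement v 5 (h 5)"
    using lay by (simp_all add: planar_layout_def)
  have "\<forall>p\<in>common_edge v 1 2. h 1 p = h 2 p" "\<forall>p\<in>common_edge v 2 5. h 2 p = h 5 p"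
    using lay by (simp_all add: planar_layout_def)
  then have glue: "h 2 B = h 1 B" "h 2 C = h 1 C" "h 5 B = h 1 B" "h 5 D = h 2 D"
    unfolding e by (metis hull_inc insertCI)+
  \<comment> \<open>\<open>b\<close> is the centre of the half hexagon and \<open>U\<close> the
    spoke to \<open>C\<close>; successive rotations by 60 degrees put \<open>D\<close> at
    \<open>W\<close> and \<open>F\<close> at \<open>W - U\<close>, and \<open>A\<close> lies at
    \<open>U - W\<close>, opposite to \<open>F\<close>.\<close>
  define b U W where "b = h 1 B" and "U = h 1 C - b" and "W = rot60 U"
  have b: "h 1 B = b" "h 2 B = b" "h 5 B = b"
    by (simp_all add: glue b_def)
  have c: "h 1 C = b + U" "h 2 C = b + U"
    by (simp_all add: glue U_def)
  have "h 2 D = b + W"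
    using flat_placement_vertices(5)[OF h(2) t2'] unfolding b c by (simp add: W_def algebra_simps)
  then have d: "h 2 D = b + W" "h 5 D = b + W"
    by (simp_all add: glue)
  have "h 5 F - b = rot60 (h 5 D - b)"
    using flat_placement_vertices(5)[OF h(3) t5''] by (simp add: b)
  then have f: "h 5 F = b + W - U"
    by (simp add: d W_def rot60_rot60 algebra_simps)
  have "h 1 A - h 1 C = rot60 (- U)"
    using flat_placement_vertices(5)[OF h(1) t1'] unfolding b c by simp
  then have a: "h 1 A = b + U - W"
    unfolding c by (simp add: W_def rot60_minus algebra_simps)
  have U1: "norm U = 1"
    using flat_placement_vertices(1)[OF h(1) t1'] unfolding b c by (simp add: dist_norm)
  obtain \<beta> \<gamma> where bg: "0 \<le> \<beta>" "0 \<le> \<gamma>" "\<beta> + \<gamma> \<le> 1" and p1: "p1 = C + \<beta> *\<^sub>R (B - C) + \<gamma> *\<^sub>R (A - C)"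
    and xy1: "x1 = \<beta> + \<gamma> / 2" "y1 = sqrt 3 / 2 * \<gamma>"
    by (rule ccw_triangle_representation[OF t1' e(1) r1])
  obtain \<beta>' \<gamma>' where bg': "0 \<le> \<beta>'" "0 \<le> \<gamma>'" "\<beta>' + \<gamma>' \<le> 1" and p2: "p2 = F + \<beta>' *\<^sub>R (B - F) + \<gamma>' *\<^sub>R (D - F)"
    and xy2: "x2 = \<beta>' + \<gamma>' / 2" "y2 = sqrt 3 / 2 * \<gamma>'"
    by (rule ccw_triangle_representation[OF t5' e(3) r2])
  have z1: "h 1 p1 = b + (1 - \<beta>) *\<^sub>R U + (- \<gamma>) *\<^sub>R W"
    unfolding p1 flat_placement_affine[OF h(1) t1' bg] a b c by (simp add: algebra_simps)
  have z2: "h 5 p2 = b + (\<beta>' + \<gamma>' - 1) *\<^sub>R U + (1 - \<beta>') *\<^sub>R W"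
    unfolding p2 flat_placement_affine[OF h(3) t5' bg'] b d f by (simp add: algebra_simps)
  have im1: "h 1 ` face v 1 = {b + \<beta> *\<^sub>R (U - W) + \<gamma> *\<^sub>R U |\<beta> \<gamma>. 0 \<le> \<beta> \<and> 0 \<le> \<gamma> \<and> \<beta> + \<gamma> \<le> 1}"
    unfolding flat_placement_image[OF h(1) t1''] a b c by simp
  have im2: "h 2 ` face v 2 = {b + \<beta> *\<^sub>R U + \<gamma> *\<^sub>R W |\<beta> \<gamma>. 0 \<le> \<beta> \<and> 0 \<le> \<gamma> \<and> \<beta> + \<gamma> \<le> 1}"
    unfolding flat_placement_image[OF h(2) t2'] b c d by simp
  have im5: "h 5 ` face v 5 = {b + \<beta> *\<^sub>R W + \<gamma> *\<^sub>R (W - U) |\<beta> \<gamma>. 0 \<le> \<beta> \<and> 0 \<le> \<gamma> \<and> \<beta> + \<gamma> \<le> 1}"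
    unfolding flat_placement_image[OF h(3) t5''] b d f by simp
  show "closed_segment (h 1 p1) (h 5 p2) \<subseteq> (\<Union>a\<in>{1,2,5}. h a ` face v a)"
  proof
    fix z assume "z \<in> closed_segment (h 1 p1) (h 5 p2)"
    then obtain x y where xy: "x \<le> 1" "y \<le> 1" "0 \<le> x + y" "x + y \<le> 1" and z: "z = b + x *\<^sub>R U + y *\<^sub>R W"
      unfolding z1 z2 by (rule half_hexagon_segment) (use bg bg' in auto)
    \<comment> \<open>The lines \<open>y = 0\<close> and \<open>x = 0\<close> contain the spokes to
      \<open>C\<close> and \<open>D\<close>, which separate the three triangles.\<close>
    consider "y \<le> 0" | "0 \<le> x" "0 \<le> y" | "x \<le> 0" by linarith
    then show "z \<in> (\<Union>a\<in>{1,2,5}. h a ` face v a)"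
    proof cases
      case 1
      have "z = b + (- y) *\<^sub>R (U - W) + (x + y) *\<^sub>R U" by (simp add: z algebra_simps)
      moreover have "0 \<le> - y" "0 \<le> x + y" "- y + (x + y) \<le> 1" using 1 xy by simp_all
      ultimately have "z \<in> h 1 ` face v 1" unfolding im1 by blast
      then show ?thesis by simp
    next
      case 2
      then have "z \<in> h 2 ` face v 2" unfolding im2 using z xy by blast
      then show ?thesis by simp
    next
      case 3
      have "z = b + (x + y) *\<^sub>R W + (- x) *\<^sub>R (W - U)" by (simp add: z algebra_simps)
      moreover have "0 \<le> - x" "0 \<le> x + y" "x + y + - x \<le> 1" using 3 xy by simp_all
      ultimately have "z \<in> h 5 ` face v 5" unfolding im5 by blast
      then show ?thesis by simp
    qed
  qed
  have "h 1 p1 - h 5 p2 = (2 - \<beta> - \<beta>' - \<gamma>') *\<^sub>R U - (\<gamma> + 1 - \<beta>') *\<^sub>R rot60 U"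
    unfolding z1 z2 W_def by (simp add: algebra_simps scaleR_2)
  then have "dist (h 1 p1) (h 5 p2) = sqrt (((2 - \<beta> - \<beta>' - \<gamma>' + (\<gamma> + 1 - \<beta>')) / 2)\<^sup>2
      + (sqrt 3 / 2 * (2 - \<beta> - \<beta>' - \<gamma>' - (\<gamma> + 1 - \<beta>')))\<^sup>2)"
    unfolding dist_norm by (simp only: norm_lattice_combination[OF U1])
  also have "(2 - \<beta> - \<beta>' - \<gamma>' + (\<gamma> + 1 - \<beta>')) / 2 = (1 - x1 + sqrt 3 * y1) / 2 - x2 + 1"
    by (simp add: xy1 xy2 field_simps)
  also have "sqrt 3 / 2 * (2 - \<beta> - \<beta>' - \<gamma>' - (\<gamma> + 1 - \<beta>')) = (sqrt 3 - sqrt 3 * x1 - y1) / 2 - y2"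
    by (simp add: xy1 xy2 field_simps)
  finally show "dist (h 1 p1) (h 5 p2) = sqrt (((1 - x1 + sqrt 3 * y1) / 2 - x2 + 1)\<^sup>2
                      + ((sqrt 3 - sqrt 3 * x1 - y1) / 2 - y2)\<^sup>2)" .
qed

section \<open>A net\<close>

lemma path_edges_simps [simp]:
  "path_edges [] = {}" "path_edges [a] = {}"
  "path_edges (a # b # fs) = insert {a, b} (path_edges (b # fs))"
proof -
  show "path_edges (a # b # fs) = insert {a, b} (path_edges (b # fs))"
  proof (intro set_eqI iffI)
    fix e assume "e \<in> path_edges (a # b # fs)"
    then obtain i where i: "e = {(a # b # fs) ! i, (a # b # fs) ! Suc i}" "Suc i < length (a # b # fs)"
      by (auto simp: path_edges_def)
    then show "e \<in> insert {a, b} (path_edges (b # fs))"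
      by (cases i) (auto simp: path_edges_def)
  next
    fix e assume "e \<in> insert {a, b} (path_edges (b # fs))"
    then consider "e = {a, b}" | i where "e = {(b # fs) ! i, (b # fs) ! Suc i}" "Suc i < length (b # fs)"
      by (auto simp: path_edges_def)
    then show "e \<in> path_edges (a # b # fs)"
    proof cases
      case 1
      then show ?thesis unfolding path_edges_def by (intro CollectI exI[of _ 0]) simp
    next
      case 2
      then show ?thesis unfolding path_edges_def by (intro CollectI exI[of _ "Suc i"]) simp
    qed
  qed
qed (simp_all add: path_edges_def)

lemma path_edges_map: "path_edges (map n fs) = image n ` path_edges fs"
  by (induction fs rule: induct_list012) simp_all

lemma segment_is_path:
  assumes "distinct xs" "i \<le> j" "j < length xs"
  shows "\<exists>fs. is_path (path_edges xs) fs \<and> hd fs = xs ! i \<and> last fs = xs ! j"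
    and "\<exists>fs. is_path (path_edges xs) fs \<and> hd fs = xs ! j \<and> last fs = xs ! i"
proof -
  \<comment> \<open>\<open>Suc j - i\<close> entries include position \<open>j\<close>; the reversed
    list settles the other direction, because edges are unordered.\<close>
  define fs where "fs = take (Suc j - i) (drop i xs)"
  have len: "length fs = Suc j - i" and nth: "\<And>k. k < Suc j - i \<Longrightarrow> fs ! k = xs ! (i + k)"
    using assms by (auto simp: fs_def)
  have ne: "fs \<noteq> []" using len assms by auto
  have edge: "{xs ! k, xs ! Suc k} \<in> path_edges xs" if "Suc k < length xs" for k
    using that by (auto simp: path_edges_def)
  have succ: "successively (\<lambda>a b. {a, b} \<in> path_edges xs) fs"
    unfolding successively_conv_nth using assms by (simp add: len nth edge)
  have "distinct fs" using assms by (simp add: fs_def)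
  moreover have "hd fs = xs ! i" "last fs = xs ! j"
    using ne assms by (simp_all add: hd_conv_nth last_conv_nth len nth)
  moreover have "successively (\<lambda>a b. {a, b} \<in> path_edges xs) (rev fs)"
    using succ by (simp add: insert_commute)
  ultimately have "is_path (path_edges xs) fs \<and> hd fs = xs ! i \<and> last fs = xs ! j"
    "is_path (path_edges xs) (rev fs) \<and> hd (rev fs) = xs ! j \<and> last (rev fs) = xs ! i"
    using ne succ by (simp_all add: is_path_def hd_rev last_rev)
  then show "\<exists>fs. is_path (path_edges xs) fs \<and> hd fs = xs ! i \<and> last fs = xs ! j"
    "\<exists>fs. is_path (path_edges xs) fs \<and> hd fs = xs ! j \<and> last fs = xs ! i"
    by blast+
qed

lemma path_edges_acyclic:
  assumes xs: "distinct xs" and len: "3 \<le> length fs" and path: "is_path (path_edges xs) fs"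
    and cl: "{last fs, hd fs} \<in> path_edges xs"
  shows False
proof -
  define pos where "pos = inv_into {..<length xs} (\<lambda>i. xs ! i)"
  have pos: "pos (xs ! i) = i" if "i < length xs" for i
    unfolding pos_def using that xs by (intro inv_into_f_f) (auto simp: inj_on_nth)
  have edge: "x \<in> set xs \<and> y \<in> set xs \<and> (pos x = Suc (pos y) \<or> pos y = Suc (pos x))"
    if "{x, y} \<in> path_edges xs" for x y
    using that by (auto simp: path_edges_def doubleton_eq_iff pos)
  have inj: "x = y" if "x \<in> set xs" "y \<in> set xs" "pos x = pos y" for x y
    using that by (metis in_set_conv_nth pos)
  define nxt where "nxt k = (if Suc k = length fs then 0 else Suc k)" for k
  have nxt: "{fs ! k, fs ! nxt k} \<in> path_edges xs" if "k < length fs" for k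
  proof (cases "Suc k = length fs")
    case True
    then have "fs \<noteq> []" "k = length fs - 1" by auto
    then show ?thesis using cl True by (simp add: nxt_def last_conv_nth hd_conv_nth)
  next
    case False
    with that path show ?thesis by (simp add: nxt_def is_path_def successively_conv_nth)
  qed
  \<comment> \<open>Both neighbours on the cycle of the element with the largest position precede it in \<open>xs\<close>, so they coincide.\<close>
  define M where "M = Max ((\<lambda>k. pos (fs ! k)) ` {..<length fs})"
  have "M \<in> (\<lambda>k. pos (fs ! k)) ` {..<length fs}"
    unfolding M_def using len by (intro Max_in) (auto simp: lessThan_empty_iff)
  then obtain m where m: "m < length fs" "pos (fs ! m) = M" by auto
  have le: "pos (fs ! k) \<le> pos (fs ! m)" if "k < length fs" for k
    unfolding m(2) M_def using that by (intro Max_ge) auto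
  define l where "l = (if m = 0 then length fs - 1 else m - 1)"
  \<comment> \<open>\<open>l\<close> and \<open>nxt m\<close> are the cyclic neighbours of
    \<open>m\<close>; they differ because the cycle has length at least 3.\<close>
  have l: "l < length fs" "nxt l = m" "nxt m < length fs" "l \<noteq> nxt m"
    using len m(1) by (auto simp: l_def nxt_def)
  have mem: "fs ! nxt m \<in> set xs" "fs ! l \<in> set xs"
    and "pos (fs ! m) = Suc (pos (fs ! nxt m)) \<or> pos (fs ! nxt m) = Suc (pos (fs ! m))"
    and "pos (fs ! l) = Suc (pos (fs ! m)) \<or> pos (fs ! m) = Suc (pos (fs ! l))"
    using edge[OF nxt[OF m(1)]] edge[OF nxt[OF l(1), unfolded l(2)]] by blast+
  then have "pos (fs ! l) = pos (fs ! nxt m)"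
    using le[OF l(1)] le[OF l(3)] by linarith
  then have "fs ! l = fs ! nxt m" by (rule inj[OF mem(2,1)])
  with l path show False by (simp add: is_path_def nth_eq_iff_index_eq)
qed

lemma hamiltonian_path_spanning_tree:
  assumes xs: "distinct xs" "set xs = {1..8}" and adj: "successively adjacent xs"
  shows "spanning_tree (path_edges xs)"
  unfolding spanning_tree_def
proof (intro conjI ballI)
  show "path_edges xs \<subseteq> {{a, b} |a b. adjacent a b}"
    using adj by (auto simp: path_edges_def successively_conv_nth)
  show "\<not> (\<exists>fs. 3 \<le> length fs \<and> is_path (path_edges xs) fs \<and> {last fs, hd fs} \<in> path_edges xs)"
    using path_edges_acyclic[OF xs(1)] by blast
  fix a b assume "a \<in> {1..8::nat}" "b \<in> {1..8::nat}"
  then obtain i j where "a = xs ! i" "b = xs ! j" "i < length xs" "j < length xs"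
    unfolding xs(2)[symmetric] in_set_conv_nth by blast
  then show "\<exists>fs. is_path (path_edges xs) fs \<and> hd fs = a \<and> last fs = b"
    using segment_is_path[OF xs(1), of i j] segment_is_path[OF xs(1), of j i]
    by (cases "i \<le> j") auto
qed

section \<open>Unit triangles of the triangular lattice\<close>

definition lattice_point :: "real \<Rightarrow> real \<Rightarrow> real \<times> real" where
  "lattice_point i j = (i + j / 2, sqrt 3 / 2 * j)"

text \<open>The oblique coordinates with respect to the lattice, as inner products.\<close>

definition lattice_x :: "real \<times> real" where "lattice_x = (1, - 1 / sqrt 3)"
definition lattice_y :: "real \<times> real" where "lattice_y = (0, 2 / sqrt 3)"

text \<open>Open triangles, the two halves of a lattice rhombus, written as linear inequalities so
  that disjointness becomes linear arithmetic.\<close>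

definition up_cell :: "real \<Rightarrow> real \<Rightarrow> (real \<times> real) set" where
  "up_cell i j = {z. i < lattice_x \<bullet> z \<and> j < lattice_y \<bullet> z \<and> (lattice_x + lattice_y) \<bullet> z < i + j + 1}"

definition down_cell :: "real \<Rightarrow> real \<Rightarrow> (real \<times> real) set" where
  "down_cell i j = {z. lattice_x \<bullet> z < i + 1 \<and> lattice_y \<bullet> z < j + 1 \<and> i + j + 1 < (lattice_x + lattice_y) \<bullet> z}"

lemma lattice_coordinates:
  "lattice_x \<bullet> lattice_point i j = i" "lattice_y \<bullet> lattice_point i j = j"
  by (simp_all add: lattice_x_def lattice_y_def lattice_point_def field_simps)

lemma lattice_functionals_nonzero: "lattice_x \<noteq> 0" "lattice_y \<noteq> 0" "lattice_x + lattice_y \<noteq> 0"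
  by (simp_all add: lattice_x_def lattice_y_def prod_eq_iff)

lemma up_triangle:
  "dist (lattice_point i j) (lattice_point (i + 1) j) = 1"
  "dist (lattice_point (i + 1) j) (lattice_point i (j + 1)) = 1"
  "dist (lattice_point i j) (lattice_point i (j + 1)) = 1"
  "0 < plane_orientation (lattice_point i j) (lattice_point (i + 1) j) (lattice_point i (j + 1))"
  by (simp_all add: lattice_point_def plane_orientation_def dist_norm norm_real_pair power2_eq_square field_simps)

lemma down_triangle:
  "dist (lattice_point (i + 1) j) (lattice_point (i + 1) (j + 1)) = 1"
  "dist (lattice_point (i + 1) (j + 1)) (lattice_point i (j + 1)) = 1"
  "dist (lattice_point (i + 1) j) (lattice_point i (j + 1)) = 1"
  "0 < plane_orientation (lattice_point (i + 1) j) (lattice_point (i + 1) (j + 1)) (lattice_point i (j + 1))"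
  by (simp_all add: lattice_point_def plane_orientation_def dist_norm norm_real_pair power2_eq_square field_simps)

text \<open>The image lies in three closed half-planes, whose interiors are the open ones since the
  functionals are nonzero. This inclusion is enough for proving that interiors do not meet.\<close>

lemma up_placement:
  assumes t: "ccw_triangle v a P Q R"
  obtains g where "flat_placement v a g" "g P = lattice_point i j" "g Q = lattice_point (i + 1) j"
    "g R = lattice_point i (j + 1)" "interior (g ` face v a) \<subseteq> up_cell i j"
proof -
  obtain g where g: "flat_placement v a g" "g P = lattice_point i j" "g Q = lattice_point (i + 1) j"
    "g R = lattice_point i (j + 1)"
    using flat_placement_exists[OF t up_triangle] by blast
  have "g ` face v a \<subseteq> {z. lattice_x \<bullet> z \<ge> i} \<inter> {z. lattice_y \<bullet> z \<ge> j}
      \<inter> {z. (lattice_x + lattice_y) \<bullet> z \<le> i + j + 1}"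
    unfolding flat_placement_image[OF g(1) t] g
    by (intro subsetI, elim CollectE exE conjE, hypsubst)
      (simp add: lattice_coordinates algebra_simps)
  from interior_mono[OF this] have "interior (g ` face v a) \<subseteq> up_cell i j"
    by (auto simp: up_cell_def lattice_functionals_nonzero)
  with g that show thesis by blast
qed

lemma down_placement:
  assumes t: "ccw_triangle v a P Q R"
  obtains g where "flat_placement v a g" "g P = lattice_point (i + 1) j" "g Q = lattice_point (i + 1) (j + 1)"
    "g R = lattice_point i (j + 1)" "interior (g ` face v a) \<subseteq> down_cell i j"
proof -
  obtain g where g: "flat_placement v a g" "g P = lattice_point (i + 1) j"
    "g Q = lattice_point (i + 1) (j + 1)" "g R = lattice_point i (j + 1)"
    using flat_placement_exists[OF t down_triangle] by blast
  have "g ` face v a \<subseteq> {z. lattice_x \<bullet> z \<le> i + 1} \<inter> {z. lattice_y \<bullet> z \<le> j + 1}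
      \<inter> {z. (lattice_x + lattice_y) \<bullet> z \<ge> i + j + 1}"
    unfolding flat_placement_image[OF g(1) t] g
    by (intro subsetI, elim CollectE exE conjE, hypsubst)
      (simp add: lattice_coordinates algebra_simps)
  from interior_mono[OF this] have "interior (g ` face v a) \<subseteq> down_cell i j"
    by (auto simp: down_cell_def lattice_functionals_nonzero)
  with g that show thesis by blast
qed

text \<open>Both maps are affine on the edge, so its endpoints decide. Seen from outside,
  neighbouring faces traverse their common edge in opposite directions, hence \<open>Q P R'\<close>
  and the parameter \<open>1 - t\<close>.\<close>

lemma flat_placements_agree:
  assumes "flat_placement v a g" "ccw_triangle v a P Q R" "flat_placement v b g'" "ccw_triangle v b Q P R'"
    and "g P = g' P" "g Q = g' Q" and p: "p \<in> convex hull {P, Q}"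
  shows "g p = g' p"
proof -
  obtain t where t: "0 \<le> t" "t \<le> 1" "p = (1 - t) *\<^sub>R P + t *\<^sub>R Q"
    using p by (auto simp: closed_segment_def simp flip: segment_convex_hull)
  have "g p = (1 - t) *\<^sub>R g P + t *\<^sub>R g Q"
    using flat_placement_edge[OF assms(1,2), of t] t by simp
  moreover have "g' p = t *\<^sub>R g' Q + (1 - t) *\<^sub>R g' P"
    using flat_placement_edge[OF assms(3,4), of "1 - t"] t by (simp add: add.commute)
  ultimately show ?thesis using assms(5,6) by (simp add: add.commute)
qed

text \<open>
  The faces 2, 5, 6, 7, 4, 3 form a straight strip of six triangles; 1 and 8 are flaps on opposite
  sides of it.
\<close>

abbreviation strip :: "nat list" where "strip \<equiv> [1, 2, 5, 6, 7, 4, 3, 8]"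

lemma strip_layout:
  assumes oct: "unit_octahedron v"
  shows "\<exists>h. planar_layout v {1..8} (path_edges strip) h"
proof -
  define A B C D E F where "A = v {1,4,6,7}" and "B = v {1,2,5,6}" and "C = v {1,2,3,4}"
    and "D = v {2,3,5,8}" and "E = v {3,4,7,8}" and "F = v {5,6,7,8}"
  note defs = A_def B_def C_def D_def E_def F_def
  note rot = ccw_triangle_rotate
  have t1: "ccw_triangle v 1 A C B" and t2: "ccw_triangle v 2 D B C" and t3: "ccw_triangle v 3 D C E"
    and t4: "ccw_triangle v 4 A E C" and t5: "ccw_triangle v 5 D F B" and t6: "ccw_triangle v 6 A B F"
    and t7: "ccw_triangle v 7 A F E" and t8: "ccw_triangle v 8 D E F"
    using unit_octahedron_faces[OF oct] by (simp_all only: defs)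
  \<comment> \<open>The strip fills row 0 of the lattice with alternating down and up cells; face 1
    sits on the top edge of face 2, and face 8 hangs from the bottom edge of face 3.\<close>
  obtain g1 where g1: "flat_placement v 1 g1" "g1 C = lattice_point 0 1" "g1 B = lattice_point 1 1"
      "g1 A = lattice_point 0 2" and c1: "interior (g1 ` face v 1) \<subseteq> up_cell 0 1"
    using up_placement[OF rot[OF t1], of 0 1] by auto
  obtain g2 where g2: "flat_placement v 2 g2" "g2 D = lattice_point 1 0" "g2 B = lattice_point 1 1"
      "g2 C = lattice_point 0 1" and c2: "interior (g2 ` face v 2) \<subseteq> down_cell 0 0"
    using down_placement[OF t2, of 0 0] by auto
  obtain g5 where g5: "flat_placement v 5 g5" "g5 D = lattice_point 1 0" "g5 F = lattice_point 2 0"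
      "g5 B = lattice_point 1 1" and c5: "interior (g5 ` face v 5) \<subseteq> up_cell 1 0"
    using up_placement[OF t5, of 1 0] by auto
  obtain g6 where g6: "flat_placement v 6 g6" "g6 F = lattice_point 2 0" "g6 A = lattice_point 2 1"
      "g6 B = lattice_point 1 1" and c6: "interior (g6 ` face v 6) \<subseteq> down_cell 1 0"
    using down_placement[OF rot[OF rot[OF t6]], of 1 0] by auto
  obtain g7 where g7: "flat_placement v 7 g7" "g7 F = lattice_point 2 0" "g7 E = lattice_point 3 0"
      "g7 A = lattice_point 2 1" and c7: "interior (g7 ` face v 7) \<subseteq> up_cell 2 0"
    using up_placement[OF rot[OF t7], of 2 0] by auto
  obtain g4 where g4: "flat_placement v 4 g4" "g4 E = lattice_point 3 0" "g4 C = lattice_point 3 1"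
      "g4 A = lattice_point 2 1" and c4: "interior (g4 ` face v 4) \<subseteq> down_cell 2 0"
    using down_placement[OF rot[OF t4], of 2 0] by auto
  obtain g3 where g3: "flat_placement v 3 g3" "g3 E = lattice_point 3 0" "g3 D = lattice_point 4 0"
      "g3 C = lattice_point 3 1" and c3: "interior (g3 ` face v 3) \<subseteq> up_cell 3 0"
    using up_placement[OF rot[OF rot[OF t3]], of 3 0] by auto
  obtain g8 where g8: "flat_placement v 8 g8" "g8 F = lattice_point 4 (- 1)" "g8 D = lattice_point 4 0"
      "g8 E = lattice_point 3 0" and c8: "interior (g8 ` face v 8) \<subseteq> down_cell 3 (- 1)"
    using down_placement[OF rot[OF rot[OF t8]], of 3 "- 1"] by auto
  \<comment> \<open>The default value of the update chain serves face 1.\<close>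
  define h where "h = (\<lambda>_::nat. g1)(2 := g2, 3 := g3, 4 := g4, 5 := g5, 6 := g6, 7 := g7, 8 := g8)"
  have h: "h 1 = g1" "h 2 = g2" "h 3 = g3" "h 4 = g4" "h 5 = g5" "h 6 = g6" "h 7 = g7" "h 8 = g8"
    by (simp_all add: h_def)
  define cell where "cell = (\<lambda>_::nat. up_cell 0 1)(2 := down_cell 0 0, 3 := up_cell 3 0, 4 := down_cell 2 0,
    5 := up_cell 1 0, 6 := down_cell 1 0, 7 := up_cell 2 0, 8 := down_cell 3 (- 1 :: real))"
  have cells: "cell 1 = up_cell 0 1" "cell 2 = down_cell 0 0" "cell 3 = up_cell 3 0" "cell 4 = down_cell 2 0"
    "cell 5 = up_cell 1 0" "cell 6 = down_cell 1 0" "cell 7 = up_cell 2 0" "cell 8 = down_cell 3 (- 1)"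
    by (simp_all add: cell_def)
  have in_cell: "interior (h a ` face v a) \<subseteq> cell a" if "a \<in> {1,2,3,4,5,6,7,8}" for a
    using that by (elim insertE emptyE) (simp_all only: h cells c1 c2 c3 c4 c5 c6 c7 c8)
  have placed: "flat_placement v a (h a)" if "a \<in> {1,2,3,4,5,6,7,8}" for a
    using that by (elim insertE emptyE) (simp_all only: h g1 g2 g3 g4 g5 g6 g7 g8)
  have cell_disjoint: "cell a \<inter> cell b = {}"
    if "a \<in> {1,2,3,4,5,6,7,8}" "b \<in> {1,2,3,4,5,6,7,8}" "a \<noteq> b" for a b
    using that by (elim insertE emptyE; hypsubst)
      (simp_all only: cells up_cell_def down_cell_def inner_add_left simp_thms, auto)
  note e = path_edge_endpoints[of v, folded defs]
  have glue: "\<forall>p\<in>common_edge v 1 2. h 1 p = h 2 p" "\<forall>p\<in>common_edge v 2 5. h 2 p = h 5 p"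
    "\<forall>p\<in>common_edge v 5 6. h 5 p = h 6 p" "\<forall>p\<in>common_edge v 6 7. h 6 p = h 7 p"
    "\<forall>p\<in>common_edge v 7 4. h 7 p = h 4 p" "\<forall>p\<in>common_edge v 4 3. h 4 p = h 3 p"
    "\<forall>p\<in>common_edge v 3 8. h 3 p = h 8 p"
    unfolding h e
    using flat_placements_agree[OF g1(1) rot[OF t1] g2(1) rot[OF t2]]
      flat_placements_agree[OF g5(1) rot[OF rot[OF t5]] g2(1) t2]
      flat_placements_agree[OF g5(1) rot[OF t5] g6(1) rot[OF t6]]
      flat_placements_agree[OF g6(1) rot[OF rot[OF t6]] g7(1) t7]
      flat_placements_agree[OF g7(1) rot[OF rot[OF t7]] g4(1) t4]
      flat_placements_agree[OF g4(1) rot[OF t4] g3(1) rot[OF t3]]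
      flat_placements_agree[OF g3(1) rot[OF rot[OF t3]] g8(1) t8]
    by (simp_all add: g1 g2 g3 g4 g5 g6 g7 g8 insert_commute)
  have glued: "h a p = h b p" if ab: "{a, b} \<in> path_edges strip" and p: "p \<in> common_edge v a b" for a b p
  proof -
    \<comment> \<open>Each edge in the direction in which \<open>glue\<close> states it; the reverse
      direction follows from \<open>common_edge_commute\<close>.\<close>
    define K where "K = {(1::nat,2),(2,5),(5,6),(6,7),(7,4),(4,3),(3,8::nat)}"
    have K: "\<forall>p\<in>common_edge v a b. h a p = h b p" if "(a, b) \<in> K" for a b
      using that unfolding K_def
      by (elim insertE emptyE; unfold prod.inject; elim conjE; hypsubst; intro glue)
    have edges: "path_edges strip = (\<lambda>(a, b). {a, b}) ` K"
      by (simp add: K_def)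
    obtain a' b' where K': "(a', b') \<in> K" and "{a, b} = {a', b'}"
      using ab unfolding edges by auto
    then consider "a = a'" "b = b'" | "a = b'" "b = a'"
      by (auto simp only: doubleton_eq_iff)
    then show ?thesis
      using K[OF K'] p common_edge_commute[of v a b] by cases simp_all
  qed
  have "planar_layout v {1,2,3,4,5,6,7,8} (path_edges strip) h"
    unfolding planar_layout_def using placed glued in_cell cell_disjoint
    by (meson disjoint_iff subsetD)
  then show ?thesis unfolding atLeast1AtMost8 by blast
qed

section \<open>Restriction, reversal and transport of layouts\<close>

lemma planar_layout_cong:
  assumes "planar_layout v A T h" "\<And>a. a \<in> A \<Longrightarrow> h' a = h a"
  shows "planar_layout v A T h'"
  using assms unfolding planar_layout_def by simp

lemma planar_layout_mono:
  assumes "planar_layout v A T h" "A' \<subseteq> A" "T' \<subseteq> T"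
  shows "planar_layout v A' T' h"
  using assms unfolding planar_layout_def by (simp add: subset_iff)

text \<open>Reversal keeps the set of faces and the set of edges, so \<open>SOME\<close> picks the
  same layout on both sides.\<close>

lemma trail_length_reverse:
  "trail_length v [a, b, c] q1 q2 = trail_length v [c, b, a] q2 q1"
proof -
  have "set [a, b, c] = set [c, b, a]" "path_edges [a, b, c] = path_edges [c, b, a]"
    by (auto simp: insert_commute)
  then show ?thesis
    unfolding trail_length_def by (simp only: Let_def closed_segment_commute dist_commute)
qed

context relabeled_octahedron
begin

lemma strip_net:
  assumes "unit_octahedron w"
  obtains h where "spanning_tree (path_edges (map n strip))" "planar_layout v {1..8} (path_edges (map n strip)) h"
proof -
  have strip: "set strip = {1..8}" "distinct strip" "successively adjacent strip"
    unfolding atLeast1AtMost8 by (auto simp: adjacent_iff)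
  have "distinct (map n strip)"
    using n_inj strip by (simp only: distinct_map)
  moreover have "set (map n strip) = {1..8}"
    using n_bij strip(1) by (simp only: set_map bij_betw_def)
  moreover have "successively adjacent (map n strip)"
  proof -
    have "adjacent (n a) (n b)" if "adjacent a b" for a b
      using that adjacent_eq adjacent_range by blast
    then show ?thesis using strip(3) by (simp add: successively_map)
  qed
  ultimately have tree: "spanning_tree (path_edges (map n strip))"
    by (rule hamiltonian_path_spanning_tree)
  obtain h0 where "planar_layout w {1..8} (path_edges strip) h0"
    using strip_layout[OF assms] by blast
  \<comment> \<open>\<open>h0\<close> is indexed by the labels of \<open>w\<close>; composing with
    the inverse of \<open>n\<close> reindexes it by those of \<open>v\<close>.\<close>
  then have "planar_layout w {1..8} (path_edges strip) ((h0 \<circ> inv_into {1..8} n) \<circ> n)"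
    by (rule planar_layout_cong) (simp add: n_inj del: One_nat_def)
  moreover have "\<Union>(path_edges strip) \<subseteq> {1..8}" by auto
  ultimately have "planar_layout v (n ` {1..8}) (image n ` path_edges strip) (h0 \<circ> inv_into {1..8} n)"
    by (simp only: planar_layout_eq[OF order_refl])
  then have "planar_layout v {1..8} (path_edges (map n strip)) (h0 \<circ> inv_into {1..8} n)"
    using n_bij by (simp only: bij_betw_def path_edges_map)
  with tree that show thesis by blast
qed

lemma landscape_three_faces:
  assumes "unit_octahedron w"
  shows "is_landscape v [n 1, n 2, n 5]"
proof -
  obtain h where "spanning_tree (path_edges (map n strip))" "planar_layout v {1..8} (path_edges (map n strip)) h"
    using strip_net[OF assms] by blast
  then have "is_net v (path_edges (map n strip))" by (auto simp: is_net_def)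
  moreover have "is_path (path_edges (map n strip)) [n 1, n 2, n 5]"
    using n_inj by (simp add: is_path_def inj_on_eq_iff)
  ultimately show ?thesis by (auto simp: is_landscape_def)
qed

text \<open>The layout of the net restricts to the landscape, so the layout chosen by
  \<open>trail_length\<close> is a genuine one and \<open>layout_trail\<close> applies to
  it.\<close>

lemma trail_length_three_faces:
  assumes oct: "unit_octahedron w"
    and rep: "is_representation v p1 (n 1) (n 2) x1 y1" "is_representation v p2 (n 5) (n 6) x2 y2"
  shows "trail_length v [n 1, n 2, n 5] (n 1, p1) (n 5, p2) =
           ereal (sqrt (((1 - x1 + sqrt 3 * y1) / 2 - x2 + 1)\<^sup>2
                      + ((sqrt 3 - sqrt 3 * x1 - y1) / 2 - y2)\<^sup>2))"
proof -
  define L where "L = [n 1, n 2, n 5]"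
  define h where "h = (SOME h. planar_layout v (set L) (path_edges L) h)"
  have L: "set L = n ` {1,2,5}" "path_edges L = image n ` {{1,2},{2,5}}"
    by (simp_all add: L_def)
  obtain h0 where "planar_layout v {1..8} (path_edges (map n strip)) h0"
    using strip_net[OF oct] by blast
  then have "planar_layout v (set L) (path_edges L) h0"
    by (rule planar_layout_mono) (use n_range in \<open>simp_all add: L_def\<close>)
  then have "\<exists>h. planar_layout v (set L) (path_edges L) h" by blast
  then have "planar_layout v (set L) (path_edges L) h"
    unfolding h_def by (rule someI_ex)
  then have lay: "planar_layout w {1,2,5} {{1,2},{2,5}} (h \<circ> n)"
    unfolding L by (subst (asm) planar_layout_eq) simp_all
  have rep': "is_representation w p1 1 2 x1 y1" "is_representation w p2 5 6 x2 y2"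
    using rep is_representation_eq by simp_all
  have faces: "(\<Union>a\<in>set L. h a ` face v a) = (\<Union>a\<in>{1,2,5}. (h \<circ> n) a ` face w a)"
    using face_eq[of 1] face_eq[of 2] face_eq[of 5] by (simp add: L_def)
  show ?thesis
    using layout_trail[OF oct lay rep']
    unfolding trail_length_def L_def[symmetric] h_def[symmetric] Let_def faces fst_conv snd_conv o_apply
    by simp
qed

end

theorem theorem3:
  fixes v :: "nat set \<Rightarrow> real^3" and n :: "nat \<Rightarrow> nat"
    and p1 p2 :: "real^3" and x1 y1 x2 y2 :: real
  assumes "unit_octahedron v"
    and "admissible_labeling v n"
    and "n 1 \<noteq> n 5" and "\<not> opposite (n 1) (n 5)" and "\<not> adjacent (n 1) (n 5)"
    and "is_representation v p1 (n 1) (n 2) x1 y1"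
    and "is_representation v p2 (n 5) (n 6) x2 y2"
  shows "{L. is_landscape v L \<and> length L = 3 \<and> hd L = n 1 \<and> last L = n 5}
           = {[n 1, n 2, n 5], [n 1, n 6, n 5]} \<and>
         [n 1, n 2, n 5] \<noteq> [n 1, n 6, n 5] \<and>
         trail_length v [n 1, n 2, n 5] (n 1, p1) (n 5, p2) =
           ereal (sqrt (((1 - x1 + sqrt 3 * y1) / 2 - x2 + 1)\<^sup>2
                      + ((sqrt 3 - sqrt 3 * x1 - y1) / 2 - y2)\<^sup>2)) \<and>
         trail_length v [n 1, n 6, n 5] (n 1, p1) (n 5, p2) =
           ereal (sqrt ((x1 - 1 - (1 - x2 + sqrt 3 * y2) / 2)\<^sup>2
                      + (y1 - (sqrt 3 - sqrt 3 * x2 - y2) / 2)\<^sup>2))"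
proof -
  define w where "w S = v (n ` S)" for S
  have oct: "octahedral_relabeling n"
    using assms(2) by (rule admissible_labeling_octahedral)
  interpret relabeled_octahedron v w n
    by unfold_locales (simp_all add: oct w_def)
  \<comment> \<open>The orientation clause of the labelling is an equivalence whose right-hand side
    belongs to \<open>unit_octahedron\<close>.\<close>
  have "clockwise_around v (n 1) (n 2) (n 4) (n 6)"
    using assms(1,2) by (simp add: admissible_labeling_def unit_octahedron_frame)
  then have w_oct: "unit_octahedron w"
    using assms(1) clockwise_around_eq[of 1 2 4 6] by (intro unit_octahedron_relabel) simp_all
  define w' where "w' S = w (rotate_labels ` S)" for S
  interpret rotated: relabeled_octahedron v w' "n \<circ> rotate_labels"
    by unfold_locales
      (simp_all add: octahedral_relabeling_comp rotate_labels_octahedral oct w'_def w_def image_comp)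
  have w'_oct: "unit_octahedron w'"
    unfolding w'_def by (rule unit_octahedron_rotate[OF w_oct])
  have rot: "(n \<circ> rotate_labels) 1 = n 5" "(n \<circ> rotate_labels) 2 = n 6"
    "(n \<circ> rotate_labels) 5 = n 1" "(n \<circ> rotate_labels) 6 = n 2"
    by (simp_all add: rotate_labels_def)
  have "is_landscape v [n 5, n 6, n 1]"
    using rotated.landscape_three_faces[OF w'_oct] unfolding rot .
  \<comment> \<open>The same net serves for the reversed list.\<close>
  then have "is_landscape v [n 1, n 6, n 5]"
    by (auto simp: is_landscape_def is_path_def insert_commute)
  moreover have "is_landscape v [n 1, n 2, n 5]"
    by (rule landscape_three_faces[OF w_oct])
  moreover have "L \<in> {[n 1, n 2, n 5], [n 1, n 6, n 5]}"
    if L: "is_landscape v L" "length L = 3" "hd L = n 1" "last L = n 5" for L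
  proof -
    obtain m where m: "L = [n 1, m, n 5]"
      using L(2-4) by (auto simp: numeral_3_eq_3 length_Suc_conv)
    obtain T where T: "T \<subseteq> {{a, b} |a b. adjacent a b}" and path: "is_path T L"
      using L(1) unfolding is_landscape_def is_net_def spanning_tree_def by blast
    have "adjacent a b" if "{a, b} \<in> T" for a b
      using subsetD[OF T that] adjacent_commute by (auto simp: doubleton_eq_iff)
    then have "adjacent (n 1) m" "adjacent m (n 5)"
      using path by (simp_all add: m is_path_def)
    moreover obtain k where k: "k \<in> {1..8}" "m = n k"
      using adjacent_range[OF \<open>adjacent (n 1) m\<close>] n_bij unfolding bij_betw_def by blast
    ultimately have "adjacent 1 k" "adjacent k 5"
      using adjacent_eq[of 1 k] adjacent_eq[of k 5] by simp_all
    \<comment> \<open>Faces 1 and 5 meet only at the vertex \<open>{1,2,5,6}\<close>; their common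
      neighbours are the other two faces there.\<close>
    then have "k = 2 \<or> k = 6" by (auto simp: adjacent_iff)
    then show ?thesis by (auto simp: m k)
  qed
  ultimately have "{L. is_landscape v L \<and> length L = 3 \<and> hd L = n 1 \<and> last L = n 5}
      = {[n 1, n 2, n 5], [n 1, n 6, n 5]}"
    by auto
  moreover have "n 2 \<noteq> n 6"
    using n_inj by (simp add: inj_on_eq_iff)
  moreover note trail_length_three_faces[OF w_oct assms(6,7)]
  moreover have "trail_length v [n 1, n 6, n 5] (n 1, p1) (n 5, p2) =
      ereal (sqrt (((1 - x2 + sqrt 3 * y2) / 2 - x1 + 1)\<^sup>2
                 + ((sqrt 3 - sqrt 3 * x2 - y2) / 2 - y1)\<^sup>2))"
    using rotated.trail_length_three_faces[OF w'_oct, unfolded rot, OF assms(7,6)]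
    by (simp only: trail_length_reverse[of v "n 1"])
  \<comment> \<open>The half-turn yields the differences with the opposite sign, which squaring
    removes.\<close>
  moreover have "((1 - x2 + sqrt 3 * y2) / 2 - x1 + 1)\<^sup>2 = (x1 - 1 - (1 - x2 + sqrt 3 * y2) / 2)\<^sup>2"
    "((sqrt 3 - sqrt 3 * x2 - y2) / 2 - y1)\<^sup>2 = (y1 - (sqrt 3 - sqrt 3 * x2 - y2) / 2)\<^sup>2"
    by (simp_all add: power2_eq_square algebra_simps)
  ultimately show ?thesis by simp
qed

end
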